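(* Assume the embedding matrices $U\in\mathbb R^{d_1\times(N+1)}$, $V\in\mathbb R^{d_2\times(k+2)}$, $Z\in\mathbb R^{d_3\times3}$ all have full column rank. Then for any $a_{b,0},a_{b,1},a_{c,0},a_{c,1},a_{q,0},a_{q,\times},a_{p,1}\in\mathbb R$ and any $\lambda=(\lambda_1,\dots,\lambda_k)^\top\in\mathbb R^k$ there exists $\theta=\{B,C,P,Q\}$ such that the induced matrices $A_B=U^\top BU$, $A_C=Z^\top CZ$, $A_P=PV$, $A_Q=QZ$ satisfy $$A_B=\begin{pmatrix}0&a_{b,0}1_{1\times N}\\0_{N\times1}&a_{b,1}I_N\end{pmatrix},\qquad A_C=\begin{pmatrix}a_{c,0}&-a_{c,1}&0\\-a_{c,0}&a_{c,1}&0\\0&0&0\end{pmatrix},$$ $$A_P=\begin{pmatrix}0_{k\times1}&-a_{p,1}I_k&0_{k\times1}\\0&0_{1\times k}&0\end{pmatrix},\qquad A_Q=\begin{pmatrix}\lambda&0_{k\times1}&0_{k\times1}\\-a_{q,0}&a_{q,\times}&0\end{pmatrix}.$$ Moreover, for any $k\ge2$, $L\in\mathbb N_+$, $N\ge\frac{k^{L+1}-1}{k-1}$ and precision $\epsilon>0$, there exists an absolute constant $C_0>0$ such that when $$e^{a_{c,0}}\ge\ln k,\quad e^{a_{c,1}}\ge\sqrt{Nk}\,\ln k,\quad e^{a_{b,0}}\ge Nk\ln k,\quad e^{a_{b,1}}\ge\ln k\;e^{a_{b,0}},$$ $$\lambda_i-\lambda_{i+1}\asymp a_{q,0}\asymp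 a_{q,\times}\gtrsim\lambda_k\ge0,\qquad \lambda_i-\lambda_{i+1},\ a_{q,0},\ a_{q,\times}\ge C_0\ln(N/\epsilon)\qquad\text{for all }i\in[k-1],$$ $$\frac{a_{p,1}}{k}\asymp\lambda_1,\qquad\frac{a_{p,1}}{k}\ge C_0\big(\ln(N/\epsilon)+a_{q,0}+\lambda_1\big),$$ then for any $\Phi=(\mathcal T,g(\mathcal T))$, where $\mathcal T$ is a full $k$-ary tree with depth $l\in[L]$ and $g(\mathcal T)$ is an arbitrary leaf, and any reachable non-terminal state $s_h$, $$R(\pi_\theta;\Phi)\ge1-\epsilon,\qquad\big\|\pi_\theta(\cdot\mid s_h)-\pi^\star(\cdot\mid s_h)\big\|_\infty\le\frac{\epsilon}{2N},$$ where $\pi^\star$ is the ranked DFS policy.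
   Context: **Notation.** $[n]=\{1,\dots,n\}$; $1_{m\times n},0_{m\times n}$ are the all-ones and all-zeros matrices, $I_n$ the identity. $x\gtrsim y$ means $x\ge c\,y$ for some absolute constant $c>0$; $x\asymp y$ means $x\gtrsim y$ and $y\gtrsim x$. **Environment.** $k\ge2$. A full $k$-ary tree is a rooted tree in which each node has either $k$ (ordered, indexed $1,\dots,k$) children or none; its nodes are distinct elements of $[N]$; depth is the maximal distance from the root to a leaf. An environment is $\Phi=(\mathcal T,g(\mathcal T))$ with $g(\mathcal T)$ a leaf (the goal), not shown to the agent. The agent starts at the root $n_1$. At step $h$ it is at node $n_h$ and picks $a_h\in\{\mathrm{down}_1,\dots,\mathrm{down}_k,\mathrm{up}\}$ ($\mathrm{up}$: go to the parent; $\mathrm{down}_i$: go to the $i$-th child). An action is illegal if it is $\mathrm{up}$ at the root, or $\mathrm{down}_i$ at a leaf, or has already been taken at $n_h$ earlier in the episode. A legal action moves the agent deterministically to $n_{h+1}$. The agent observes $o_h=(n_h,c_h)$ with $c_h=0$ if $n_h$ is not a leaf, $c_h=\times$ if $n_h$ is a leaf other than the goal, $c_h=\checkmark$ if $n_h$ is the goal. The episode ends when $c_h=\checkmark$ (success) or an illegal action is taken; the maximum length is $H=2N$. The state at step $h$ is the history $s_h=(o_1,a_1,\dots,o_{h-1},a_{h-1},o_h)$; it is reachable and non-terminal if it arises from legal actions and the episode has not ended. $R(\pi;\Phi)$ is the probability that policy $\pi$ reaches the goal in $\Phi$. **Ranked DFS policy.** The goal distribution is imbalanced, with branch probabilities indexed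 in decreasing order $p^a_1>p^a_2>\dots>p^a_k>0$. At any reachable non-terminal state, if the current node has unvisited children, $\pi^\star$ moves to the unvisited child $j$ with the largest $p^a_j$ (i.e. smallest index); otherwise (including at a non-goal leaf) it takes $\mathrm{up}$. **Transformer policy.** $U=(u_0,\dots,u_N)$: $u_i\in\mathbb R^{d_1}$ embeds node $i\in[N]$, $u_0$ is a filler. $V=(v_0,\dots,v_{k+1})$: $v_i\in\mathbb R^{d_2}$ embeds $\mathrm{down}_i$ for $i\in[k]$, $v_{k+1}$ embeds $\mathrm{up}$, $v_0$ is a filler. $Z=(z_0,z_1,z_2)$: embeddings in $\mathbb R^{d_3}$ of the labels $0,\times,\checkmark$. Let $\overline n_h,\overline a_h,\overline c_h$ be the embeddings of $n_h,a_h,c_h$, and $$E_n^{(h)}=(u_0,\overline n_1,\dots,\overline n_{h-1}),\quad E_a^{(h)}=(v_0,\overline a_1,\dots,\overline a_{h-1}),\quad E_c^{(h)}=(\overline c_1,\dots,\overline c_h).$$ Parameters: $B\in\mathbb R^{d_1\times d_1}$, $C\in\mathbb R^{d_3\times d_3}$, $P\in\mathbb R^{(k+1)\times d_2}$, $Q\in\mathbb R^{(k+1)\times d_3}$. At step $h$, $$\pi_\theta(\cdot\mid s_h)=\mathrm{softmax}\Big(PE_a^{(h)}\,\mathrm{softmax}\big(E_n^{(h)\top}B\,\overline n_h\big)+QE_c^{(h)}\,\mathrm{softmax}\big(E_c^{(h)\top}C\,\overline c_h\big)\Big),$$ whose coordinates $1,\dots,k$ are the probabilities of $\mathrm{down}_1,\dots,\mathrm{down}_k$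 and coordinate $k+1$ that of $\mathrm{up}$.
   Formalization: Precision is restricted to ε ≤ 1, and in the lower bounds on e^{a_{c,0}}, e^{a_{c,1}}, e^{a_{b,0}} the factor ln k is replaced by max(C_1, ln k), with C_1 depending only on the implicit constants in ≍ and ≳; as literally stated the claim fails (e.g. k=2, or ε=N). *)

theory Defs
  imports "HOL-Probability.Probability" "Jordan_Normal_Form.DL_Rank"
begin

subsection \<open>Trees and environments\<close>

datatype ktree = Node (label: nat) (children: "ktree list")

fun full_kary :: "nat \<Rightarrow> ktree \<Rightarrow> bool" where
  "full_kary k (Node n ts) \<longleftrightarrow> ts = [] \<or> (length ts = k \<and> (\<forall>t\<in>set ts. full_kary k t))"

fun nodes :: "ktree \<Rightarrow> nat list" where
  "nodes (Node n ts) = n # concat (map nodes ts)"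

fun depth :: "ktree \<Rightarrow> nat" where
  "depth (Node n ts) = (if ts = [] then 0 else Suc (Max (set (map depth ts))))"

fun subtrees :: "ktree \<Rightarrow> ktree set" where
  "subtrees (Node n ts) = insert (Node n ts) (\<Union>t\<in>set ts. subtrees t)"

definition full_kary_tree :: "nat \<Rightarrow> nat \<Rightarrow> ktree \<Rightarrow> bool" where
  "full_kary_tree k N T \<longleftrightarrow> full_kary k T \<and> distinct (nodes T) \<and> set (nodes T) \<subseteq> {1..N}"

definition is_leaf :: "ktree \<Rightarrow> nat \<Rightarrow> bool" where
  "is_leaf T n \<longleftrightarrow> Node n [] \<in> subtrees T"

text \<open>\<open>is_child T n i m\<close>: node \<open>m\<close> is the \<open>i\<close>-th child of node \<open>n\<close>, counting from 1.\<close>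

definition is_child :: "ktree \<Rightarrow> nat \<Rightarrow> nat \<Rightarrow> nat \<Rightarrow> bool" where
  "is_child T n i m \<longleftrightarrow>
     (\<exists>ts. Node n ts \<in> subtrees T \<and> 1 \<le> i \<and> i \<le> length ts \<and> label (ts ! (i - 1)) = m)"

type_synonym env = "ktree \<times> nat"

definition environment :: "nat \<Rightarrow> nat \<Rightarrow> nat \<Rightarrow> env \<Rightarrow> bool" where
  "environment k N L \<Phi> \<longleftrightarrow>
     full_kary_tree k N (fst \<Phi>) \<and> depth (fst \<Phi>) \<in> {1..L} \<and> is_leaf (fst \<Phi>) (snd \<Phi>)"

subsection \<open>Histories, legal actions, reachable states\<close>

datatype action = Down nat | Up

definition actions :: "nat \<Rightarrow> action set" where
  "actions k = insert Up (Down ` {1..k})"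

datatype mark = Zero | Cross | Check

type_synonym obs = "nat \<times> mark"

text \<open>The state \<open>(o\<^sub>1, a\<^sub>1, \<dots>, o\<^sub>h\<^sub>-\<^sub>1, a\<^sub>h\<^sub>-\<^sub>1, o\<^sub>h)\<close> is encoded as the list of the pairs
  \<open>(o\<^sub>j, a\<^sub>j)\<close>, \<open>j < h\<close>, in chronological order, together with \<open>o\<^sub>h\<close>.\<close>

type_synonym state = "(obs \<times> action) list \<times> obs"

definition observe :: "env \<Rightarrow> nat \<Rightarrow> obs" where
  "observe \<Phi> n =
     (n, if \<not> is_leaf (fst \<Phi>) n then Zero else if n = snd \<Phi> then Check else Cross)"

definition cur_node :: "state \<Rightarrow> nat" where
  "cur_node s = fst (snd s)"

definition cur_mark :: "state \<Rightarrow> mark" where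
  "cur_mark s = snd (snd s)"

definition cur_step :: "state \<Rightarrow> nat" where
  "cur_step s = Suc (length (fst s))"

definition success :: "state \<Rightarrow> bool" where
  "success s \<longleftrightarrow> cur_mark s = Check"

definition taken :: "state \<Rightarrow> (nat \<times> action) set" where
  "taken s = (\<lambda>(ob, a). (fst ob, a)) ` set (fst s)"

definition legal :: "env \<Rightarrow> state \<Rightarrow> action \<Rightarrow> bool" where
  "legal \<Phi> s a \<longleftrightarrow> (cur_node s, a) \<notin> taken s \<and>
     (case a of Down i \<Rightarrow> \<exists>m. is_child (fst \<Phi>) (cur_node s) i m
              | Up \<Rightarrow> cur_node s \<noteq> label (fst \<Phi>))"

definition target :: "ktree \<Rightarrow> nat \<Rightarrow> action \<Rightarrow> nat" where
  "target T n a = (case a of Down i \<Rightarrow> THE m. is_child T n i m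
                           | Up \<Rightarrow> THE m. \<exists>i. is_child T m i n)"

definition init_state :: "env \<Rightarrow> state" where
  "init_state \<Phi> = ([], observe \<Phi> (label (fst \<Phi>)))"

definition next_state :: "env \<Rightarrow> state \<Rightarrow> action \<Rightarrow> state" where
  "next_state \<Phi> s a =
     (fst s @ [(snd s, a)], observe \<Phi> (target (fst \<Phi>) (cur_node s) a))"

definition horizon :: "nat \<Rightarrow> nat" where
  "horizon N = 2 * N"

inductive reachable :: "nat \<Rightarrow> env \<Rightarrow> state \<Rightarrow> bool" for N \<Phi> where
  init: "reachable N \<Phi> (init_state \<Phi>)"
| step: "\<lbrakk>reachable N \<Phi> s; \<not> success s; cur_step s < horizon N; legal \<Phi> s a\<rbrakk>
           \<Longrightarrow> reachable N \<Phi> (next_state \<Phi> s a)"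

subsection \<open>Policies and their success probability\<close>

type_synonym policy = "state \<Rightarrow> action pmf"

text \<open>Distribution of the final state of an episode with at most \<open>m\<close> more actions. An illegal
  action ends the episode in the current (unsuccessful) state.\<close>

primrec episode :: "env \<Rightarrow> policy \<Rightarrow> nat \<Rightarrow> state \<Rightarrow> state pmf" where
  "episode \<Phi> \<pi> 0 s = return_pmf s"
| "episode \<Phi> \<pi> (Suc m) s =
     (if success s then return_pmf s
      else bind_pmf (\<pi> s) (\<lambda>a. if legal \<Phi> s a then episode \<Phi> \<pi> m (next_state \<Phi> s a)
                              else return_pmf s))"

definition success_prob :: "nat \<Rightarrow> policy \<Rightarrow> env \<Rightarrow> real" where
  "success_prob N \<pi> \<Phi> =
     measure_pmf.prob (episode \<Phi> \<pi> (horizon N) (init_state \<Phi>)) {s. success s}"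

definition sup_dist :: "nat \<Rightarrow> action pmf \<Rightarrow> action pmf \<Rightarrow> real" where
  "sup_dist k p q = Max ((\<lambda>a. \<bar>pmf p a - pmf q a\<bar>) ` actions k)"

definition visited :: "state \<Rightarrow> nat set" where
  "visited s = insert (cur_node s) ((\<lambda>(ob, a). fst ob) ` set (fst s))"

definition unvisited_children :: "env \<Rightarrow> state \<Rightarrow> nat set" where
  "unvisited_children \<Phi> s =
     {j. \<exists>m. is_child (fst \<Phi>) (cur_node s) j m \<and> m \<notin> visited s}"

definition branch_probs :: "nat \<Rightarrow> (nat \<Rightarrow> real) \<Rightarrow> bool" where
  "branch_probs k p \<longleftrightarrow> (\<forall>i\<in>{1..<k}. p i > p (Suc i)) \<and> p k > 0"

definition ranked_dfs :: "(nat \<Rightarrow> real) \<Rightarrow> env \<Rightarrow> policy" where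
  "ranked_dfs p \<Phi> s = return_pmf
     (if unvisited_children \<Phi> s \<noteq> {}
      then Down (arg_max p (\<lambda>j. j \<in> unvisited_children \<Phi> s)) else Up)"

subsection \<open>The transformer policy\<close>

definition softmax :: "real vec \<Rightarrow> real vec" where
  "softmax x = vec (dim_vec x) (\<lambda>i. exp (x $ i) / (\<Sum>j<dim_vec x. exp (x $ j)))"

text \<open>Column \<open>i\<close> of the embedding matrices is \<open>u\<^sub>i\<close>, \<open>v\<^sub>i\<close>, \<open>z\<^sub>i\<close>; column 0 of \<open>U\<close> and \<open>V\<close> is
  the filler.\<close>

definition full_col_rank :: "real mat \<Rightarrow> bool" where
  "full_col_rank A \<longleftrightarrow> vec_space.rank (dim_row A) A = dim_col A"

definition embeddings ::
  "nat \<Rightarrow> nat \<Rightarrow> nat \<Rightarrow> nat \<Rightarrow> nat \<Rightarrow> real mat \<Rightarrow> real mat \<Rightarrow> real mat \<Rightarrow> bool" where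
  "embeddings k N d1 d2 d3 U V Z \<longleftrightarrow>
     U \<in> carrier_mat d1 (N + 1) \<and> V \<in> carrier_mat d2 (k + 2) \<and> Z \<in> carrier_mat d3 3 \<and>
     full_col_rank U \<and> full_col_rank V \<and> full_col_rank Z"

definition emb_node :: "real mat \<Rightarrow> nat \<Rightarrow> real vec" where
  "emb_node U n = col U n"

definition emb_action :: "nat \<Rightarrow> real mat \<Rightarrow> action \<Rightarrow> real vec" where
  "emb_action k V a = (case a of Down i \<Rightarrow> col V i | Up \<Rightarrow> col V (k + 1))"

definition emb_mark :: "real mat \<Rightarrow> mark \<Rightarrow> real vec" where
  "emb_mark Z c = (case c of Zero \<Rightarrow> col Z 0 | Cross \<Rightarrow> col Z 1 | Check \<Rightarrow> col Z 2)"

definition E_n :: "real mat \<Rightarrow> state \<Rightarrow> real mat" where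
  "E_n U s = mat_of_cols (dim_row U)
     (col U 0 # map (\<lambda>((n, c), a). emb_node U n) (fst s))"

definition E_a :: "nat \<Rightarrow> real mat \<Rightarrow> state \<Rightarrow> real mat" where
  "E_a k V s = mat_of_cols (dim_row V)
     (col V 0 # map (\<lambda>((n, c), a). emb_action k V a) (fst s))"

definition E_c :: "real mat \<Rightarrow> state \<Rightarrow> real mat" where
  "E_c Z s = mat_of_cols (dim_row Z)
     (map (\<lambda>((n, c), a). emb_mark Z c) (fst s) @ [emb_mark Z (cur_mark s)])"

definition parameters ::
  "nat \<Rightarrow> nat \<Rightarrow> nat \<Rightarrow> nat \<Rightarrow> real mat \<Rightarrow> real mat \<Rightarrow> real mat \<Rightarrow> real mat \<Rightarrow> bool" where
  "parameters k d1 d2 d3 B C P Q \<longleftrightarrow>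
     B \<in> carrier_mat d1 d1 \<and> C \<in> carrier_mat d3 d3 \<and>
     P \<in> carrier_mat (k + 1) d2 \<and> Q \<in> carrier_mat (k + 1) d3"

definition transformer_probs ::
  "nat \<Rightarrow> real mat \<Rightarrow> real mat \<Rightarrow> real mat \<Rightarrow> real mat \<Rightarrow> real mat \<Rightarrow> real mat \<Rightarrow> real mat
     \<Rightarrow> state \<Rightarrow> real vec" where
  "transformer_probs k U V Z B C P Q s = softmax
     (P * E_a k V s *\<^sub>v softmax (transpose_mat (E_n U s) * B *\<^sub>v emb_node U (cur_node s)) +
      Q * E_c Z s *\<^sub>v softmax (transpose_mat (E_c Z s) * C *\<^sub>v emb_mark Z (cur_mark s)))"

text \<open>Vectors are indexed from 0: entry \<open>i - 1\<close> belongs to \<open>Down i\<close> and entry \<open>k\<close> to \<open>Up\<close>.\<close>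

definition transformer_policy ::
  "nat \<Rightarrow> real mat \<Rightarrow> real mat \<Rightarrow> real mat \<Rightarrow> real mat \<Rightarrow> real mat \<Rightarrow> real mat \<Rightarrow> real mat
     \<Rightarrow> policy" where
  "transformer_policy k U V Z B C P Q s = embed_pmf (\<lambda>a. case a of
       Down i \<Rightarrow> if i \<in> {1..k} then transformer_probs k U V Z B C P Q s $ (i - 1) else 0
     | Up \<Rightarrow> transformer_probs k U V Z B C P Q s $ k)"

subsection \<open>The prescribed induced matrices\<close>

definition A_B :: "nat \<Rightarrow> real \<Rightarrow> real \<Rightarrow> real mat" where
  "A_B N ab0 ab1 = mat (N + 1) (N + 1) (\<lambda>(i, j).
     if i = 0 then (if j = 0 then 0 else ab0) else if i = j then ab1 else 0)"

definition A_C :: "real \<Rightarrow> real \<Rightarrow> real mat" where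
  "A_C ac0 ac1 = mat_of_rows_list 3
     [[  ac0, - ac1, 0],
      [- ac0,   ac1, 0],
      [    0,     0, 0]]"

definition A_P :: "nat \<Rightarrow> real \<Rightarrow> real mat" where
  "A_P k ap1 = mat (k + 1) (k + 2) (\<lambda>(i, j). if i < k \<and> j = i + 1 then - ap1 else 0)"

text \<open>\<open>lam i\<close>, \<open>i = 1, \<dots>, k\<close>, are the entries of \<open>\<lambda>\<close>; matrix rows are indexed from 0.\<close>

definition A_Q :: "nat \<Rightarrow> (nat \<Rightarrow> real) \<Rightarrow> real \<Rightarrow> real \<Rightarrow> real mat" where
  "A_Q k lam aq0 aqx = mat (k + 1) 3 (\<lambda>(i, j).
     if i < k then (if j = 0 then lam (i + 1) else 0)
     else if j = 0 then - aq0 else if j = 1 then aqx else 0)"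

definition induced ::
  "nat \<Rightarrow> nat \<Rightarrow> real mat \<Rightarrow> real mat \<Rightarrow> real mat \<Rightarrow> real mat \<Rightarrow> real mat \<Rightarrow> real mat \<Rightarrow> real mat
     \<Rightarrow> real \<Rightarrow> real \<Rightarrow> real \<Rightarrow> real \<Rightarrow> real \<Rightarrow> real \<Rightarrow> real \<Rightarrow> (nat \<Rightarrow> real) \<Rightarrow> bool" where
  "induced k N U V Z B C P Q ab0 ab1 ac0 ac1 aq0 aqx ap1 lam \<longleftrightarrow>
     transpose_mat U * B * U = A_B N ab0 ab1 \<and>
     transpose_mat Z * C * Z = A_C ac0 ac1 \<and>
     P * V = A_P k ap1 \<and>
     Q * Z = A_Q k lam aq0 aqx"

subsection \<open>Comparison up to constants\<close>

definition gtrsim :: "real \<Rightarrow> real \<Rightarrow> real \<Rightarrow> bool" where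
  "gtrsim c x y \<longleftrightarrow> x \<ge> c * y"

definition comparable :: "real \<Rightarrow> real \<Rightarrow> real \<Rightarrow> bool" where
  "comparable c x y \<longleftrightarrow> gtrsim c x y \<and> gtrsim c y x"

text \<open>\<open>ln_floor C\<^sub>1 k\<close> is \<open>ln k\<close> as soon as \<open>k \<ge> exp C\<^sub>1\<close>. The lower bounds
  on \<open>exp a\<close> have to exceed an absolute constant, which \<open>ln k\<close> alone does not for small \<open>k\<close>:
  for \<open>k = 2\<close> the bound \<open>exp ac0 \<ge> ln 2\<close> even allows \<open>ac0 < 0\<close>, and then at the root of a
  tree of depth 1, after the history \<open>root, Down 1, leaf, Up, root\<close>, with \<open>aq0 = aqx\<close> and
  \<open>lam 2 = 0\<close>, \<open>Up\<close> is preferred to the unvisited \<open>Down 2\<close>.\<close>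

definition ln_floor :: "real \<Rightarrow> nat \<Rightarrow> real" where
  "ln_floor C1 k = max C1 (ln (real k))"

end

theory Submission
  imports Defs
begin

text \<open>
  With full column rank the embeddings have left inverses, so every induced matrix can be prescribed.
  Given the induced matrices, a reachable state yields explicit logits: \<open>lam i * z - ap1 * W i\<close> for
  \<open>Down i\<close> and \<open>- aq0 * z + aqx * w\<close> for \<open>Up\<close>, where \<open>z\<close>, \<open>w\<close> are the attention weights of the
  marks \<open>Zero\<close>, \<open>Cross\<close> and \<open>W i\<close> is the attention weight of the earlier moves \<open>Down i\<close>.

  If \<open>Down i\<close> was already taken at the current node, then \<open>W i\<close> is of order \<open>1 / k\<close>, since at most
  \<open>k + 1\<close> moves were made there; the penalty \<open>ap1 / k\<close> dominates everything else. Otherwise \<open>W i\<close> is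
  noise caused by other nodes: each internal node contributes once and there are at most \<open>N / k\<close> of
  them, which makes the noise a small multiple of \<open>aq0\<close>. A cross is always preceded by a visit to an
  internal node, so at an internal node \<open>z\<close> dominates \<open>w\<close>; at a leaf \<open>w\<close> dominates \<open>z\<close>. In all cases
  the action of the ranked DFS wins by a margin of at least \<open>3 * ln (N / \<epsilon>)\<close>.

  The history has fewer than \<open>2 * N\<close> moves because legal moves never repeat, and the DFS, which only
  leaves a node after visiting all its children, never makes an illegal move before reaching the goal.
  A union bound over the episode gives the success probability.
\<close>

section \<open>Linear algebra of embeddings and attention\<close>

no_notation Finite_Cartesian_Product.vec_nth (infixl "$" 90)
no_notation inner (infix "\<bullet>" 70)

section \<open>Left inverses of embeddings, and induced matrices with prescribed entries\<close>

lemma scalar_prod_self_eq_0: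
  fixes v :: "real vec"
  assumes "v \<in> carrier_vec n" "v \<bullet> v = 0"
  shows "v = 0\<^sub>v n"
proof (rule eq_vecI)
  fix i assume i: "i < dim_vec (0\<^sub>v n :: real vec)"
  have "(\<Sum>j\<in>{0..<n}. v $ j * v $ j) = 0"
    using assms by (simp add: scalar_prod_def)
  then have "\<forall>j\<in>{0..<n}. v $ j * v $ j = 0"
    by (subst (asm) sum_nonneg_eq_0_iff) auto
  then show "v $ i = 0\<^sub>v n $ i" using i by auto
qed (use assms in auto)

lemma full_col_rank_kernel:
  assumes A: "A \<in> carrier_mat n m" and r: "full_col_rank A"
    and v: "v \<in> carrier_vec m" "A *\<^sub>v v = 0\<^sub>v n"
  shows "v = 0\<^sub>v m"
proof (rule ccontr)
  interpret vec_space "TYPE(real)" n .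
  assume "v \<noteq> 0\<^sub>v m"
  have rk: "rank A = m" using r A by (auto simp: full_col_rank_def)
  \<comment> \<open>Linear independence is a property of the set of columns, so repetitions are
    excluded first: they would leave fewer than \<open>m\<close> distinct columns, too few for rank
    \<open>m\<close>.\<close>
  have d: "distinct (cols A)"
  proof (rule ccontr)
    assume nd: "\<not> distinct (cols A)"
    obtain S where S: "maximal S (\<lambda>T. T \<subseteq> set (cols A) \<and> lin_indpt T)"
      using maximal_exists[of "(\<lambda>T. T \<subseteq> set (cols A) \<and> lin_indpt T)" "card (set (cols A))" "{}"]
      by (meson List.finite_set card_mono empty_iff empty_subsetI finite_lin_indpt2 rev_finite_subset)
    then have "card S \<le> card (set (cols A))" by (simp add: card_mono maximal_def)
    moreover have "card (set (cols A)) < m"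
      using nd A card_distinct card_length[of "cols A"] by (metis carrier_matD(2) cols_length nat_less_le)
    ultimately show False using rank_card_indpt[OF A S] rk by simp
  qed
  show False
    using lin_depI[OF A v(1) \<open>v \<noteq> 0\<^sub>v m\<close> v(2) d] full_rank_lin_indpt[OF A rk d] by simp
qed

text \<open>The Gram matrix \<open>G\<close> of the columns is invertible, because \<open>A\<close>
  maps a kernel vector of \<open>G\<close> to a vector of length zero. The left inverse is the
  inverse of \<open>G\<close> times the transpose of \<open>A\<close>, written with the
  adjugate.\<close>

lemma full_col_rank_left_inverse:
  assumes A: "A \<in> carrier_mat n m" and r: "full_col_rank A"
  obtains W where "W \<in> carrier_mat m n" "W * A = 1\<^sub>m m"
proof -
  define G where "G = transpose_mat A * A"
  have G: "G \<in> carrier_mat m m" using A by (simp add: G_def)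
  have dG: "det G \<noteq> 0"
  proof
    assume "det G = 0"
    then obtain v where v: "v \<in> carrier_vec m" "v \<noteq> 0\<^sub>v m" "G *\<^sub>v v = 0\<^sub>v m"
      using det_0_iff_vec_prod_zero_field[OF G] by auto
    have Av: "A *\<^sub>v v \<in> carrier_vec n" using A v by auto
    have "(A *\<^sub>v v) \<bullet> (A *\<^sub>v v) = v \<bullet> (transpose_mat A *\<^sub>v (A *\<^sub>v v))"
      using transpose_vec_mult_scalar[OF A v(1) Av] comm_scalar_prod[of v m] A v Av by auto
    also have "\<dots> = v \<bullet> (G *\<^sub>v v)" using A v by (simp add: G_def assoc_mult_mat_vec[of _ m n _ m])
    also have "\<dots> = 0" using v by simp
    finally have "A *\<^sub>v v = 0\<^sub>v n" using scalar_prod_self_eq_0[OF Av] by simp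
    then show False using full_col_rank_kernel[OF A r v(1)] v by simp
  qed
  define W where "W = (1 / det G) \<cdot>\<^sub>m (adj_mat G * transpose_mat A)"
  have W: "W \<in> carrier_mat m n" using adj_mat(1)[OF G] A by (simp add: W_def)
  have "W * A = (1 / det G) \<cdot>\<^sub>m (adj_mat G * G)"
    using adj_mat(1)[OF G] A by (simp add: W_def G_def mult_smult_assoc_mat[of _ m n _ m] assoc_mult_mat[of _ m m _ n _ m])
  also have "\<dots> = 1\<^sub>m m" using adj_mat(3)[OF G] dG by auto
  finally show thesis using that W by blast
qed

text \<open>With a left inverse \<open>W\<close> of \<open>U\<close>, the form
  \<open>transpose_mat W * M * W\<close> works: \<open>W * U\<close> cancels on the right and its
  transpose on the left.\<close>

lemma bilinear_form_exists:
  assumes U: "U \<in> carrier_mat d n" and r: "full_col_rank U" and M: "M \<in> carrier_mat n n"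
  obtains B where "B \<in> carrier_mat d d" "transpose_mat U * B * U = M"
proof -
  obtain W where W: "W \<in> carrier_mat n d" "W * U = 1\<^sub>m n" using full_col_rank_left_inverse[OF U r] .
  have WT: "transpose_mat U * transpose_mat W = 1\<^sub>m n"
    using W U by (metis transpose_mult transpose_one)
  have "transpose_mat U * (transpose_mat W * M * W) * U
      = (transpose_mat U * transpose_mat W) * M * (W * U)"
    using U W M by (simp add: assoc_mult_mat[of _ n d _ d _ n] assoc_mult_mat[of _ n d _ n _ d]
       assoc_mult_mat[of _ d n _ n _ d] assoc_mult_mat[of _ d n _ d _ n] assoc_mult_mat[of _ n n _ d _ n]
       assoc_mult_mat[of _ n d _ n _ n]  assoc_mult_mat[of _ n n _ n _ n] del: W(2))
  then show thesis using that[of "transpose_mat W * M * W"] W WT U M by auto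
qed

lemma linear_map_exists:
  assumes V: "V \<in> carrier_mat d n" and r: "full_col_rank V" and M: "M \<in> carrier_mat m n"
  obtains P where "P \<in> carrier_mat m d" "P * V = M"
proof -
  obtain W where W: "W \<in> carrier_mat n d" "W * V = 1\<^sub>m n" using full_col_rank_left_inverse[OF V r] .
  have "M * W * V = M" using V W M by (simp add: assoc_mult_mat[of _ m n _ d _ n])
  then show thesis using that[of "M * W"] W M by auto
qed

lemma A_C_carrier: "A_C ac0 ac1 \<in> carrier_mat 3 3"
  by (rule carrier_matI) (simp_all add: A_C_def mat_of_rows_list_def)

lemma induced_parameters_exist:
  assumes "embeddings k N d1 d2 d3 U V Z"
  shows "\<exists>B C P Q. parameters k d1 d2 d3 B C P Q \<and>
         induced k N U V Z B C P Q ab0 ab1 ac0 ac1 aq0 aqx ap1 lam"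
proof -
  have U: "U \<in> carrier_mat d1 (N + 1)" "full_col_rank U"
    and V: "V \<in> carrier_mat d2 (k + 2)" "full_col_rank V"
    and Z: "Z \<in> carrier_mat d3 3" "full_col_rank Z" using assms by (auto simp: embeddings_def)
  have "A_B N ab0 ab1 \<in> carrier_mat (N + 1) (N + 1)" by (simp add: A_B_def)
  from bilinear_form_exists[OF U this]
  obtain B where "B \<in> carrier_mat d1 d1" "transpose_mat U * B * U = A_B N ab0 ab1" .
  moreover from bilinear_form_exists[OF Z A_C_carrier]
  obtain C where "C \<in> carrier_mat d3 d3" "transpose_mat Z * C * Z = A_C ac0 ac1" .
  moreover have "A_P k ap1 \<in> carrier_mat (k + 1) (k + 2)" by (simp add: A_P_def)
  from linear_map_exists[OF V this]
  obtain P where "P \<in> carrier_mat (k + 1) d2" "P * V = A_P k ap1" .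
  moreover have "A_Q k lam aq0 aqx \<in> carrier_mat (k + 1) 3" by (simp add: A_Q_def)
  from linear_map_exists[OF Z this]
  obtain Q where "Q \<in> carrier_mat (k + 1) d3" "Q * Z = A_Q k lam aq0 aqx" .
  ultimately show ?thesis unfolding parameters_def induced_def by blast
qed

text \<open>An embedded sequence is a selection of columns of \<open>U\<close>, so its scores are a
  selection of entries of the induced matrix. Together with \<open>attention_values\<close> this
  eliminates the embeddings from the policy.\<close>

lemma attention_scores:
  fixes U B :: "real mat"
  assumes U: "U \<in> carrier_mat d n" and B: "B \<in> carrier_mat d d"
    and js: "set js \<subseteq> {..<n}" and x: "x < n"
  shows "transpose_mat (mat_of_cols d (map (col U) js)) * B *\<^sub>v col U x
       = vec (length js) (\<lambda>j. (transpose_mat U * B * U) $$ (js ! j, x))"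
proof (rule eq_vecI)
  fix j assume "j < dim_vec (vec (length js) (\<lambda>j. (transpose_mat U * B * U) $$ (js ! j, x)))"
  then have j: "j < length js" by simp
  then have jn: "js ! j < n" using js nth_mem by blast
  let ?E = "mat_of_cols d (map (col U) js)"
  have E: "?E \<in> carrier_mat d (length js)" by (simp add: carrier_matI)
  have cx: "col U x \<in> carrier_vec d" using U x by simp
  have "(transpose_mat ?E * B *\<^sub>v col U x) $ j = (transpose_mat ?E *\<^sub>v (B *\<^sub>v col U x)) $ j"
    using E B cx by (simp add: assoc_mult_mat_vec[of _ "length js" d _ d])
  also have "\<dots> = col U (js ! j) \<bullet> (B *\<^sub>v col U x)"
    using j jn E U by (simp add: col_mat_of_cols)
  also have "\<dots> = (transpose_mat U *\<^sub>v (B *\<^sub>v col U x)) $ (js ! j)"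
    using jn U by simp
  also have "\<dots> = (transpose_mat U * (B * U)) $$ (js ! j, x)"
    using jn x U B by (simp add: mult_mat_vec_def)
  finally show "(transpose_mat ?E * B *\<^sub>v col U x) $ j
     = vec (length js) (\<lambda>j. (transpose_mat U * B * U) $$ (js ! j, x)) $ j"
    using j U B by (simp add: assoc_mult_mat[of _ n d _ d _ n])
qed simp

lemma attention_values:
  fixes P V :: "real mat"
  assumes P: "P \<in> carrier_mat r d" and V: "V \<in> carrier_mat d n"
    and js: "set js \<subseteq> {..<n}" and w: "w \<in> carrier_vec (length js)"
  shows "P * mat_of_cols d (map (col V) js) *\<^sub>v w
       = vec r (\<lambda>i. \<Sum>j<length js. (P * V) $$ (i, js ! j) * w $ j)"
proof (rule eq_vecI)
  fix i assume "i < dim_vec (vec r (\<lambda>i. \<Sum>j<length js. (P * V) $$ (i, js ! j) * w $ j))"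
  then have i: "i < r" by simp
  have "(P * mat_of_cols d (map (col V) js)) $$ (i, j) = (P * V) $$ (i, js ! j)"
    if "j < length js" for j
  proof -
    have "js ! j < n" using js that nth_mem by blast
    then show ?thesis using that i P V by (simp add: col_mat_of_cols)
  qed
  then show "(P * mat_of_cols d (map (col V) js) *\<^sub>v w) $ i
      = vec r (\<lambda>i. \<Sum>j<length js. (P * V) $$ (i, js ! j) * w $ j) $ i"
    using i P w by (auto simp: mult_mat_vec_def scalar_prod_def atLeast0LessThan intro!: sum.cong)
qed (use P in simp)

section \<open>Trees and reachable states\<close>

lemma subtrees_refl: "t \<in> subtrees t"
  by (cases t) simp

lemma label_in_nodes: "label t \<in> set (nodes t)"
  by (cases t) simp

lemma subtrees_nodes_subset: "s \<in> subtrees t \<Longrightarrow> set (nodes s) \<subseteq> set (nodes t)"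
  by (induction t) auto

lemma subtrees_child: "Node n ts \<in> subtrees T \<Longrightarrow> t \<in> set ts \<Longrightarrow> t \<in> subtrees T"
  by (induction T) (auto intro: subtrees_refl)

lemma node_subtree_exists: "n \<in> set (nodes T) \<Longrightarrow> \<exists>ts. Node n ts \<in> subtrees T"
  by (induction T) (auto, blast+)

lemma full_kary_subtree:
  "full_kary k T \<Longrightarrow> Node n ts \<in> subtrees T \<Longrightarrow> ts = [] \<or> length ts = k"
  by (induction T) auto

text \<open>Used with \<open>f = nodes\<close>: sibling subtrees share no label, so a label fixes
  the index of the sibling that contains it.\<close>

lemma distinct_concat_map_index:
  assumes "distinct (concat (map f ts))" "i < length ts" "j < length ts"
    "x \<in> set (f (ts ! i))" "x \<in> set (f (ts ! j))"
  shows "i = j"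
  using assms
proof (induction ts arbitrary: i j)
  case (Cons t ts)
  have x: "x \<in> set (concat (map f ts))" if "q < length ts" "x \<in> set (f (ts ! q))" for q
    using that by force
  have disj: "x \<notin> set (concat (map f ts))" if "x \<in> set (f t)"
    using Cons.prems(1) that by (auto simp del: set_concat)
  show ?case
  proof (cases i)
    case 0
    then show ?thesis using x[of "j - 1"] disj Cons.prems(3-5) by (cases j) (simp_all del: set_concat)
  next
    case (Suc i')
    show ?thesis
    proof (cases j)
      case 0
      then show ?thesis using Suc x[of i'] disj Cons.prems(2-5) by (simp del: set_concat)
    next
      case (Suc j')
      then show ?thesis using \<open>i = Suc i'\<close> Cons.prems Cons.IH[of i' j'] by simp
    qed
  qed
qed simp

lemma distinct_nodes_child: "distinct (concat (map nodes ts)) \<Longrightarrow> t \<in> set ts \<Longrightarrow> distinct (nodes t)"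
  by (induction ts) auto

text \<open>This justifies speaking of a node by its label alone. A label below the root differs
  from the root's, and two equal labels below the root lie under the same child, where the induction
  hypothesis applies.\<close>

lemma subtrees_label_inj:
  assumes "distinct (nodes T)" "s \<in> subtrees T" "s' \<in> subtrees T" "label s = label s'"
  shows "s = s'"
  using assms
proof (induction T)
  case (Node n ts)
  have below: "label u \<in> set (concat (map nodes ts))" if "t \<in> set ts" "u \<in> subtrees t" for u t
    using that subtrees_nodes_subset label_in_nodes by fastforce
  consider "s = Node n ts" "s' = Node n ts"
    | t where "s = Node n ts" "t \<in> set ts" "s' \<in> subtrees t"
    | t where "s' = Node n ts" "t \<in> set ts" "s \<in> subtrees t"
    | t t' where "t \<in> set ts" "s \<in> subtrees t" "t' \<in> set ts" "s' \<in> subtrees t'"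
    using Node.prems by auto
  then show ?case
  proof cases
    case 2
    then show ?thesis using below[OF 2(2,3)] Node.prems by auto
  next
    case 3
    then show ?thesis using below[OF 3(2,3)] Node.prems by auto
  next
    case 4
    then obtain i j where ij: "i < length ts" "ts ! i = t" "j < length ts" "ts ! j = t'"
      by (metis in_set_conv_nth)
    have "label s \<in> set (nodes t)" "label s \<in> set (nodes t')"
      using 4 subtrees_nodes_subset label_in_nodes Node.prems by (metis subsetD)+
    then have "i = j"
      using distinct_concat_map_index[of nodes ts i j "label s"] ij Node.prems by auto
    then show ?thesis using Node.IH[of t] 4 ij distinct_nodes_child[of ts t] Node.prems by auto
  qed simp
qed

lemma child_label_not_root:
  assumes "distinct (nodes T)" "Node n ts \<in> subtrees T" "t \<in> set ts"
  shows "label t \<noteq> label T"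
proof (cases T)
  case (Node m us)
  have "label t \<in> set (concat (map nodes us))"
  proof (cases "Node n ts = T")
    case True
    then show ?thesis using assms Node label_in_nodes by auto
  next
    case False
    then obtain u where u: "u \<in> set us" "Node n ts \<in> subtrees u" using assms Node by auto
    then have "t \<in> subtrees u" using subtrees_child assms by blast
    then show ?thesis using u subtrees_nodes_subset label_in_nodes by fastforce
  qed
  then show ?thesis using assms Node by auto
qed

lemma unique_parent:
  assumes "distinct (nodes T)" "Node n ts \<in> subtrees T" "Node n' ts' \<in> subtrees T"
    "i < length ts" "j < length ts'" "label (ts ! i) = label (ts' ! j)"
  shows "n = n' \<and> i = j"
  using assms
proof (induction T)
  case (Node m us)
  have in_child: "label (ws ! l) \<in> set (nodes (us ! q))"
    if "q < length us" "Node w ws \<in> subtrees (us ! q)" "l < length ws" for q w ws l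
    using that subtrees_child subtrees_nodes_subset label_in_nodes by (metis nth_mem subsetD)
  have dq: "distinct (nodes (us ! q))" if "q < length us" for q
    using that Node.prems distinct_nodes_child[of us] by auto
  \<comment> \<open>A child of the root and a deeper child never share a label: otherwise
    distinctness would put both under the same child of the root, and a subtree's root would be a
    child inside that subtree.\<close>
  have diff: "label (us ! p) \<noteq> label (ws ! l)"
    if q: "q < length us" "Node w ws \<in> subtrees (us ! q)" "l < length ws" "p < length us" for q w ws l p
  proof
    assume eq: "label (us ! p) = label (ws ! l)"
    then have "p = q"
      using distinct_concat_map_index[of nodes us p q "label (us ! p)"] in_child[OF q(1,2,3)] q
        label_in_nodes[of "us ! p"] Node.prems by auto
    then show False using child_label_not_root[OF dq[OF q(1)] q(2) nth_mem[OF q(3)]] eq by simp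
  qed
  consider "Node n ts = Node m us" "Node n' ts' = Node m us"
    | q where "Node n ts = Node m us" "q < length us" "Node n' ts' \<in> subtrees (us ! q)"
    | q where "Node n' ts' = Node m us" "q < length us" "Node n ts \<in> subtrees (us ! q)"
    | q q' where "q < length us" "Node n ts \<in> subtrees (us ! q)"
        "q' < length us" "Node n' ts' \<in> subtrees (us ! q')"
    using Node.prems by (auto simp: in_set_conv_nth)
  then show ?case
  proof cases
    case 1
    then show ?thesis
      using distinct_concat_map_index[of nodes us i j "label (us ! i)"]
        label_in_nodes[of "us ! i"] label_in_nodes[of "us ! j"] Node.prems by auto
  next
    case 2
    then show ?thesis using diff[OF 2(2,3) Node.prems(5), of i] Node.prems by auto
  next
    case 3
    then show ?thesis using diff[OF 3(2,3) Node.prems(4), of j] Node.prems by auto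
  next
    case 4
    have "q = q'"
      using distinct_concat_map_index[of nodes us q q' "label (ts ! i)"]
        in_child[OF 4(1,2) Node.prems(4)] in_child[OF 4(3,4) Node.prems(5)] 4 Node.prems by auto
    then show ?thesis using Node.IH[of "us ! q"] dq[of q] 4 Node.prems by auto
  qed
qed

section \<open>The edge relation, whose reflexive transitive closure is the ancestor order\<close>

definition tree_edges :: "ktree \<Rightarrow> (nat \<times> nat) set" where
  "tree_edges T = {(n, m). \<exists>i. is_child T n i m}"

lemma tree_edges_reach:
  "t \<in> subtrees T \<Longrightarrow> x \<in> set (nodes t) \<Longrightarrow> (label t, x) \<in> (tree_edges T)\<^sup>*"
proof (induction t)
  case (Node n ts)
  show ?case
  proof (cases "x = n")
    case False
    then obtain t where t: "t \<in> set ts" "x \<in> set (nodes t)" using Node.prems by auto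
    then obtain j where j: "j < length ts" "ts ! j = t" by (metis in_set_conv_nth)
    have "is_child T n (Suc j) (label t)"
      unfolding is_child_def using Node.prems j by (intro exI[of _ ts]) auto
    then have "(n, label t) \<in> tree_edges T" by (auto simp: tree_edges_def)
    then show ?thesis
      using Node.IH[OF t(1) subtrees_child[OF Node.prems(1) t(1)] t(2)] by simp
  qed simp
qed

section \<open>Effect of one move on a state\<close>

lemma taken_next_state: "taken (next_state \<Phi> s a) = insert (cur_node s, a) (taken s)"
  by (auto simp: taken_def next_state_def cur_node_def)

lemma visited_next_state:
  "visited (next_state \<Phi> s a) = insert (target (fst \<Phi>) (cur_node s) a) (visited s)"
  by (auto simp: visited_def next_state_def cur_node_def observe_def)

lemma cur_node_next_state: "cur_node (next_state \<Phi> s a) = target (fst \<Phi>) (cur_node s) a"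
  by (simp add: next_state_def cur_node_def observe_def)

lemma init_state_simps:
  "taken (init_state \<Phi>) = {}" "visited (init_state \<Phi>) = {label (fst \<Phi>)}"
  "cur_node (init_state \<Phi>) = label (fst \<Phi>)" "cur_step (init_state \<Phi>) = 1"
  "fst (init_state \<Phi>) = []"
  by (auto simp: taken_def visited_def init_state_def cur_node_def cur_step_def observe_def)

lemma taken_visited: "(n, a) \<in> taken s \<Longrightarrow> n \<in> visited s"
  by (force simp: taken_def visited_def)

lemma cur_visited: "cur_node s \<in> visited s"
  by (simp add: visited_def)

text \<open>The current mark is included, since the mark attention also looks at the current
  position; the node attention looks at earlier positions only.\<close>

definition marks :: "state \<Rightarrow> mark list" where
  "marks s = map (\<lambda>(ob, a). snd ob) (fst s) @ [cur_mark s]"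

lemma marks_next_state:
  "marks (next_state \<Phi> s a) = marks s @ [snd (observe \<Phi> (target (fst \<Phi>) (cur_node s) a))]"
  by (simp add: marks_def next_state_def cur_mark_def)

text \<open>All outcomes of the first draw except \<open>a\<close> are discarded. This is the
  one-step estimate for the success probability of an episode.\<close>

lemma measure_bind_pmf_ge:
  "pmf p a * measure_pmf.prob (f a) A \<le> measure_pmf.prob (bind_pmf p f) A"
proof -
  have "ennreal (pmf p a * measure_pmf.prob (f a) A) = emeasure (f a) A * emeasure p {a}"
    by (simp add: emeasure_pmf_single measure_pmf.emeasure_eq_measure[of "f a"] ennreal_mult mult.commute)
  also have "\<dots> = (\<integral>\<^sup>+x. emeasure (f a) A * indicator {a} x \<partial>p)"
    by (rule nn_integral_cmult_indicator[symmetric]) simp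
  also have "\<dots> \<le> (\<integral>\<^sup>+x. emeasure (f x) A \<partial>p)"
    by (intro nn_integral_mono) (auto simp: indicator_def)
  also have "\<dots> = ennreal (measure_pmf.prob (bind_pmf p f) A)"
    by (simp add: measure_pmf.emeasure_eq_measure[symmetric])
  finally show ?thesis by simp
qed

section \<open>The tree of a fixed environment\<close>

locale kary_env =
  fixes k N L :: nat and \<Phi> :: env and T g
  assumes k2: "k \<ge> 2" and env: "environment k N L \<Phi>"
  defines "T \<equiv> fst \<Phi>" and "g \<equiv> snd \<Phi>"
begin

abbreviation "child \<equiv> is_child T"
abbreviation "top_node \<equiv> label T"
abbreviation "node_set \<equiv> set (nodes T)"

lemma T: "full_kary k T" "distinct (nodes T)" "node_set \<subseteq> {1..N}" "is_leaf T g" "depth T \<ge> 1"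
  using env by (auto simp: environment_def full_kary_tree_def T_def g_def)

lemma root_V: "top_node \<in> node_set"
  by (rule label_in_nodes)

lemma g_V: "g \<in> node_set"
  using T(4) subtrees_nodes_subset[of "Node g []" T] by (auto simp: is_leaf_def)

lemma card_V: "1 \<le> card node_set" "card node_set \<le> N"
  using card_mono[OF _ T(3)] root_V by (auto simp: Suc_le_eq card_gt_0_iff)

lemma child_nodes: assumes "child n i m" shows "n \<in> node_set" "m \<in> node_set"
proof -
  obtain ts where ts: "Node n ts \<in> subtrees T" "1 \<le> i" "i \<le> length ts" "label (ts ! (i - 1)) = m"
    using assms by (auto simp: is_child_def)
  show "n \<in> node_set" using subtrees_nodes_subset[OF ts(1)] by auto
  have "ts ! (i - 1) \<in> subtrees T" using subtrees_child[OF ts(1)] ts by auto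
  then show "m \<in> node_set" using subtrees_nodes_subset label_in_nodes ts by blast
qed

lemma child_parent_unique: assumes "child n i m" "child n' i' m" shows "n = n'" "i = i'"
proof -
  obtain ts where ts: "Node n ts \<in> subtrees T" "1 \<le> i" "i \<le> length ts" "label (ts ! (i - 1)) = m"
    using assms by (auto simp: is_child_def)
  obtain ts' where ts': "Node n' ts' \<in> subtrees T" "1 \<le> i'" "i' \<le> length ts'" "label (ts' ! (i' - 1)) = m"
    using assms by (auto simp: is_child_def)
  have "n = n' \<and> i - 1 = i' - 1"
    using unique_parent[OF T(2) ts(1) ts'(1), of "i - 1" "i' - 1"] ts ts' by auto
  then show "n = n'" "i = i'" using ts ts' by auto
qed

lemma childE:
  assumes "child n i m"
  obtains ts where "Node n ts \<in> subtrees T" "1 \<le> i" "i \<le> length ts" "label (ts ! (i - 1)) = m"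
    "ts ! (i - 1) \<in> set ts"
proof -
  obtain ts where ts: "Node n ts \<in> subtrees T" "1 \<le> i" "i \<le> length ts" "label (ts ! (i - 1)) = m"
    using assms by (auto simp: is_child_def)
  then have "ts ! (i - 1) \<in> set ts" by (intro nth_mem) auto
  then show thesis using that ts by blast
qed

lemma child_unique: assumes "child n i m" "child n i m'" shows "m = m'"
proof -
  obtain ts where ts: "Node n ts \<in> subtrees T" "label (ts ! (i - 1)) = m"
    using assms(1) by (rule childE)
  obtain ts' where ts': "Node n ts' \<in> subtrees T" "label (ts' ! (i - 1)) = m'"
    using assms(2) by (rule childE)
  show ?thesis using subtrees_label_inj[OF T(2) ts(1) ts'(1)] ts ts' by simp
qed

lemma child_not_root: "child n i m \<Longrightarrow> m \<noteq> top_node"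
  by (elim childE) (use child_label_not_root[OF T(2)] in blast)

lemma leaf_no_child: assumes "is_leaf T n" shows "\<not> child n i m"
proof
  assume "child n i m"
  then obtain ts where ts: "Node n ts \<in> subtrees T" "1 \<le> i" "i \<le> length ts" by (rule childE)
  then show False using subtrees_label_inj[OF T(2) ts(1), of "Node n []"] assms by (auto simp: is_leaf_def)
qed

lemma child_index: assumes "child n i m" shows "i \<in> {1..k}"
proof -
  obtain ts where ts: "Node n ts \<in> subtrees T" "1 \<le> i" "i \<le> length ts" using assms by (rule childE)
  then show ?thesis using full_kary_subtree[OF T(1) ts(1)] by auto
qed

lemma child_exists: assumes "n \<in> node_set" "\<not> is_leaf T n" "i \<in> {1..k}" obtains m where "child n i m"
proof -
  obtain ts where ts: "Node n ts \<in> subtrees T" using node_subtree_exists[OF assms(1)] by auto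
  have "length ts = k" using full_kary_subtree[OF T(1) ts] ts assms(2) by (auto simp: is_leaf_def)
  then have "child n i (label (ts ! (i - 1)))" using ts assms(3) unfolding is_child_def by auto
  then show thesis using that by blast
qed

text \<open>Positive depth enters here; it makes every history begin with the mark
  \<open>Zero\<close>.\<close>

lemma root_not_leaf: "\<not> is_leaf T top_node"
proof
  assume "is_leaf T top_node"
  then have "T = Node top_node []"
    using subtrees_label_inj[OF T(2) subtrees_refl, of "Node top_node []"] by (auto simp: is_leaf_def)
  then have "depth T = 0" by (metis depth.simps)
  then show False using T(5) by simp
qed

lemma parent_exists: assumes "n \<in> node_set" "n \<noteq> top_node" obtains p i where "child p i n"
proof -
  have "(top_node, n) \<in> (tree_edges T)\<^sup>*" using tree_edges_reach[OF subtrees_refl assms(1)] .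
  then obtain p where "(p, n) \<in> tree_edges T" using assms(2) by (metis rtranclE)
  then show thesis using that by (auto simp: tree_edges_def)
qed

text \<open>Induction downwards from the root. Unlike structural induction it keeps the tree
  \<open>T\<close> fixed, as invariants about states in \<open>T\<close> require.\<close>

lemma tree_induct [consumes 1, case_names top_node child]:
  assumes "n \<in> node_set" "P top_node" "\<And>n i m. n \<in> node_set \<Longrightarrow> P n \<Longrightarrow> child n i m \<Longrightarrow> P m"
  shows "P n"
proof -
  have "(top_node, n) \<in> (tree_edges T)\<^sup>*" using tree_edges_reach[OF subtrees_refl assms(1)] .
  then show ?thesis
    by (induction rule: rtrancl_induct) (use assms in \<open>auto simp: tree_edges_def dest: child_nodes\<close>)
qed

lemma tree_edges_parent: "(p, m) \<in> tree_edges T \<Longrightarrow> child n i m \<Longrightarrow> p = n"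
  using child_parent_unique(1) by (auto simp: tree_edges_def)

lemma no_edge_to_root: "(n, top_node) \<notin> tree_edges T"
  using child_not_root by (auto simp: tree_edges_def)

text \<open>A cycle through \<open>m\<close> enters \<open>m\<close> from its only parent
  \<open>n\<close>, hence passes through \<open>n\<close> as well; climbing in this way ends at the
  root, which has no incoming edge.\<close>

lemma tree_edges_acyclic: "n \<in> node_set \<Longrightarrow> (n, n) \<notin> (tree_edges T)\<^sup>+"
proof (induction rule: tree_induct)
  case top_node
  then show ?case using no_edge_to_root by (meson tranclE)
next
  case (child n i m)
  show ?case
  proof
    assume "(m, m) \<in> (tree_edges T)\<^sup>+"
    then obtain p where p: "(m, p) \<in> (tree_edges T)\<^sup>*" "(p, m) \<in> tree_edges T"
      by (metis rtrancl_eq_or_trancl tranclE)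
    then have "p = n" using tree_edges_parent child.hyps(2) by blast
    then have "(n, n) \<in> (tree_edges T)\<^sup>+" using p by (meson rtrancl_into_trancl2)
    then show False using child by simp
  qed
qed

lemma the_child: "child n i m \<Longrightarrow> (THE m. child n i m) = m"
  by (rule the_equality, assumption, rule child_unique)

lemma target_Down: "child n i m \<Longrightarrow> target T n (Down i) = m"
  by (simp add: target_def the_child)

lemma target_Up: assumes "child p i n" shows "target T n Up = p"
proof -
  have "(THE m. \<exists>i. child m i n) = p"
    by (rule the_equality) (use assms child_parent_unique(1) in blast)+
  then show ?thesis by (simp add: target_def)
qed

lemma legal_cases:
  assumes "legal \<Phi> s a" "cur_node s \<in> node_set"
  obtains (down) i m where "a = Down i" "child (cur_node s) i m" "target T (cur_node s) a = m"
    | (up) p i where "a = Up" "child p i (cur_node s)" "target T (cur_node s) a = p"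
proof (cases a)
  case (Down i)
  then obtain m where "child (cur_node s) i m" using assms by (auto simp: legal_def T_def)
  then show thesis using down Down target_Down by auto
next
  case Up
  then obtain p i where "child p i (cur_node s)" using assms parent_exists by (auto simp: legal_def T_def)
  then show thesis using up Up target_Up by auto
qed

section \<open>Invariants of reachable states\<close>

lemma reachable_cur_V: "reachable N \<Phi> s \<Longrightarrow> cur_node s \<in> node_set"
proof (induction rule: reachable.induct)
  case init
  then show ?case using root_V by (simp add: init_state_simps T_def)
next
  case (step s a)
  then show ?case
    by (elim legal_cases) (auto simp: cur_node_next_state T_def[symmetric] dest: child_nodes)
qed

text \<open>Legality and \<open>target\<close> are resolved into the relation \<open>child\<close>
  once and for all; most invariants below are proved by this rule.\<close>

lemma reachable_induct [consumes 1, case_names init down up]: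
  assumes "reachable N \<Phi> s"
    and "P (init_state \<Phi>)"
    and "\<And>s i m. reachable N \<Phi> s \<Longrightarrow> \<not> success s \<Longrightarrow> (cur_node s, Down i) \<notin> taken s \<Longrightarrow>
          child (cur_node s) i m \<Longrightarrow> target T (cur_node s) (Down i) = m \<Longrightarrow> P s \<Longrightarrow>
          P (next_state \<Phi> s (Down i))"
    and "\<And>s i p. reachable N \<Phi> s \<Longrightarrow> \<not> success s \<Longrightarrow> (cur_node s, Up) \<notin> taken s \<Longrightarrow>
          child p i (cur_node s) \<Longrightarrow> target T (cur_node s) Up = p \<Longrightarrow> P s \<Longrightarrow>
          P (next_state \<Phi> s Up)"
  shows "P s"
  using assms(1)
proof (induction rule: reachable.induct)
  case init
  then show ?case using assms(2) .
next
  case (step s a)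
  have nt: "(cur_node s, a) \<notin> taken s" using step by (auto simp: legal_def)
  from step(4) reachable_cur_V[OF step(1)] show ?case
  proof (cases rule: legal_cases)
    case (down i m)
    then show ?thesis using assms(3) step nt by blast
  next
    case (up p i)
    then show ?thesis using assms(4) step nt by blast
  qed
qed

lemmas next_simps = taken_next_state visited_next_state cur_node_next_state T_def[symmetric]

lemma reachable_taken_child:
  "reachable N \<Phi> s \<Longrightarrow> (n, Down i) \<in> taken s \<Longrightarrow> \<exists>m. child n i m \<and> m \<in> visited s"
  by (induction rule: reachable_induct) (auto simp: init_state_simps next_simps)

lemma reachable_taken_Up: "reachable N \<Phi> s \<Longrightarrow> (n, Up) \<in> taken s \<Longrightarrow> n \<in> node_set - {top_node}"
  by (induction rule: reachable_induct)
    (auto simp: init_state_simps next_simps dest: child_nodes child_not_root)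

lemma reachable_visited_V: "reachable N \<Phi> s \<Longrightarrow> visited s \<subseteq> node_set"
  by (induction rule: reachable_induct)
    (auto simp: init_state_simps next_simps T_def[symmetric] root_V dest: child_nodes)

lemma reachable_root_visited: "reachable N \<Phi> s \<Longrightarrow> top_node \<in> visited s"
  by (induction rule: reachable_induct)
    (auto simp: init_state_simps next_simps T_def[symmetric])

text \<open>A node other than the root can be entered for the first time only from its
  parent.\<close>

lemma reachable_visited_child:
  "reachable N \<Phi> s \<Longrightarrow> child n i m \<Longrightarrow> m \<in> visited s \<Longrightarrow> (n, Down i) \<in> taken s"
proof (induction arbitrary: n i m rule: reachable_induct)
  case init
  then show ?case using child_not_root by (auto simp: init_state_simps T_def[symmetric])
next
  case (down s i' m')
  show ?case
  proof (cases "m = m'")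
    case True
    then show ?thesis using child_parent_unique[OF down.prems(1)] down by (auto simp: next_simps)
  next
    case False
    then show ?thesis using down by (auto simp: next_simps)
  qed
next
  case (up s i' p)
  \<comment> \<open>The current node was once entered from its parent, so going up discovers no new
    node.\<close>
  have "(p, Down i') \<in> taken s" using up.IH[OF up.hyps(4) cur_visited] .
  then have "p \<in> visited s" by (rule taken_visited)
  then show ?case using up by (auto simp: next_simps)
qed

text \<open>The ranked DFS is defined by visited children, the logits by the moves taken at the
  current node; this connects the two.\<close>

lemma reachable_child_taken_iff:
  assumes s: "reachable N \<Phi> s" and m: "child n i m"
  shows "(n, Down i) \<in> taken s \<longleftrightarrow> m \<in> visited s"
proof
  assume "(n, Down i) \<in> taken s"
  then obtain m' where "child n i m'" "m' \<in> visited s" using reachable_taken_child[OF s] by blast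
  then show "m \<in> visited s" using child_unique[OF m] by simp
next
  assume "m \<in> visited s"
  then show "(n, Down i) \<in> taken s" by (rule reachable_visited_child[OF s m])
qed

lemma reachable_distinct: "reachable N \<Phi> s \<Longrightarrow> distinct (map (\<lambda>(ob, a). (fst ob, a)) (fst s))"
  by (induction rule: reachable_induct)
    (auto simp: init_state_simps next_state_def taken_def cur_node_def)

lemma reachable_obs: "reachable N \<Phi> s \<Longrightarrow> observe \<Phi> (cur_node s) = snd s"
  by (cases rule: reachable.cases, assumption)
    (simp_all (no_asm_simp) add: init_state_def next_state_def cur_node_def observe_def)

lemma reachable_marks:
  "reachable N \<Phi> s \<Longrightarrow> \<forall>(ob, a)\<in>set (fst s). observe \<Phi> (fst ob) = ob \<and> snd ob \<noteq> Check"
proof (induction rule: reachable_induct)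
  case (down s i m)
  then show ?case using reachable_obs[OF down.hyps(1)]
    by (auto simp: next_state_def cur_node_def success_def cur_mark_def)
next
  case (up s i p)
  then show ?case using reachable_obs[OF up.hyps(1)]
    by (auto simp: next_state_def cur_node_def success_def cur_mark_def)
qed (simp add: init_state_def)

lemma reachable_visited_goal:
  assumes s: "reachable N \<Phi> s" "\<not> success s"
  shows "g \<notin> visited s"
proof
  assume "g \<in> visited s"
  moreover have obs: "observe \<Phi> g = (g, Check)"
    using T(4) by (simp add: observe_def T_def[symmetric] g_def[symmetric])
  moreover have "cur_node s \<noteq> g"
    using s obs reachable_obs[OF s(1)] by (auto simp: success_def cur_mark_def)
  ultimately show False using reachable_marks[OF s(1)] by (fastforce simp: visited_def)
qed

text \<open>A leaf is always entered from its parent, which is internal. At an internal node one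
  \<open>Zero\<close> is held in reserve; a cross uses it up, and going up from the leaf adds a new
  one.\<close>

lemma reachable_cross_le_zero:
  "reachable N \<Phi> s \<Longrightarrow>
     count_list (marks s) Cross + (if is_leaf T (cur_node s) then 0 else 1) \<le> count_list (marks s) Zero"
proof (induction rule: reachable_induct)
  case init
  then show ?case using root_not_leaf
    by (auto simp: marks_def init_state_def cur_mark_def cur_node_def observe_def T_def[symmetric])
next
  case (down s i m)
  then have "\<not> is_leaf T (cur_node s)" using leaf_no_child by auto
  then show ?case using down by (auto simp: marks_next_state next_simps observe_def)
next
  case (up s i p)
  then have "\<not> is_leaf T p" using leaf_no_child by auto
  then show ?case using up by (auto simp: marks_next_state next_simps observe_def split: if_splits)
qed

lemma reachable_marks_no_check:
  "reachable N \<Phi> s \<Longrightarrow> \<not> success s \<Longrightarrow> Check \<notin> set (marks s)"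
  using reachable_marks[of s] by (fastforce simp: marks_def success_def)

text \<open>Once a subtree is left through \<open>Up\<close>, it is never entered again: re-entry
  would pass through its root \<open>n\<close>, but a downward move only leads to an unvisited node.
  In particular \<open>Up\<close> was never taken at the current node.\<close>

lemma reachable_Up_not_ancestor:
  "reachable N \<Phi> s \<Longrightarrow> (n, Up) \<in> taken s \<Longrightarrow> (n, cur_node s) \<notin> (tree_edges T)\<^sup>*"
proof (induction arbitrary: n rule: reachable_induct)
  case init
  then show ?case by (simp add: init_state_simps)
next
  case (down s i m)
  have n: "(n, Up) \<in> taken s" using down by (auto simp: next_simps)
  have "m \<notin> visited s" using reachable_visited_child down by blast
  then have "n \<noteq> m" using n taken_visited by blast
  show ?case
  proof
    assume "(n, cur_node (next_state \<Phi> s (Down i))) \<in> (tree_edges T)\<^sup>*"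
    then have "(n, m) \<in> (tree_edges T)\<^sup>*" using down by (simp add: next_simps)
    then obtain q where "(n, q) \<in> (tree_edges T)\<^sup>*" "(q, m) \<in> tree_edges T"
      using \<open>n \<noteq> m\<close> by (metis rtranclE)
    then have "(n, cur_node s) \<in> (tree_edges T)\<^sup>*"
      using tree_edges_parent[OF _ down.hyps(4)] by auto
    then show False using down.IH n by simp
  qed
next
  case (up s i p)
  have pe: "(p, cur_node s) \<in> tree_edges T" using up by (auto simp: tree_edges_def)
  show ?case
  proof
    assume "(n, cur_node (next_state \<Phi> s Up)) \<in> (tree_edges T)\<^sup>*"
    then have np: "(n, p) \<in> (tree_edges T)\<^sup>*" using up by (simp add: next_simps)
    show False
    proof (cases "n = cur_node s")
      case True
      then show False using np pe tree_edges_acyclic reachable_cur_V[OF up.hyps(1)]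
        by (meson rtrancl_into_trancl1)
    next
      case False
      then have "(n, Up) \<in> taken s" using up by (auto simp: next_simps)
      then show False using up.IH np pe by (meson rtrancl_into_rtrancl)
    qed
  qed
qed

text \<open>Each visited node is either still on the path from the root to the current node or has
  been left upwards. A move up removes exactly one node from that path, and this is the node where
  \<open>Up\<close> is recorded.\<close>

lemma reachable_visited_cases:
  "reachable N \<Phi> s \<Longrightarrow> n \<in> visited s \<Longrightarrow> (n, cur_node s) \<in> (tree_edges T)\<^sup>* \<or> (n, Up) \<in> taken s"
proof (induction arbitrary: n rule: reachable_induct)
  case init
  then show ?case by (simp add: init_state_simps T_def[symmetric])
next
  case (down s i m)
  have "(cur_node s, m) \<in> tree_edges T" using down by (auto simp: tree_edges_def)
  then show ?case using down by (auto simp: next_simps intro: rtrancl_into_rtrancl)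
next
  case (up s i p)
  show ?case
  proof (cases "n = p \<or> n = cur_node s \<or> (n, Up) \<in> taken s")
    case False
    then have "(n, cur_node s) \<in> (tree_edges T)\<^sup>*" using up by (auto simp: next_simps)
    then obtain q where "(n, q) \<in> (tree_edges T)\<^sup>*" "(q, cur_node s) \<in> tree_edges T"
      using False by (metis rtranclE)
    then have "(n, p) \<in> (tree_edges T)\<^sup>*"
      using tree_edges_parent[OF _ up.hyps(4)] by auto
    then show ?thesis using up by (simp add: next_simps)
  qed (use up in \<open>auto simp: next_simps\<close>)
qed

lemma card_taken: "reachable N \<Phi> s \<Longrightarrow> length (fst s) = card (taken s)"
  using distinct_card[OF reachable_distinct] by (simp add: taken_def)

lemma finite_taken: "finite (taken s)"
  by (simp add: taken_def)

text \<open>Both the downward and the upward moves are counted by the non-root end of the edge used.\<close>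

lemma reachable_length: assumes "reachable N \<Phi> s" shows "length (fst s) + 2 \<le> 2 * N"
proof -
  define e where "e = (\<lambda>(n, a). case a of Down i \<Rightarrow> (True, THE m. child n i m) | Up \<Rightarrow> (False, n))"
  have "inj_on e (taken s)"
  proof (rule inj_onI)
    fix x y assume "x \<in> taken s" "y \<in> taken s" and eq: "e x = e y"
    then obtain n a n' a' where t: "(n, a) \<in> taken s" "(n', a') \<in> taken s"
      and xy: "x = (n, a)" "y = (n', a')" by (metis surj_pair)
    consider i i' where "a = Down i" "a' = Down i'" | i where "a = Down i" "a' = Up"
      | i' where "a = Up" "a' = Down i'" | "a = Up" "a' = Up"
      by (cases a; cases a') auto
    then show "x = y"
    proof cases
      case 1
      obtain m where m: "child n i m" using t 1 reachable_taken_child[OF assms] by blast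
      obtain m' where m': "child n' i' m'" using t 1 reachable_taken_child[OF assms] by blast
      have "m = m'" using eq xy 1 by (simp add: e_def the_child[OF m] the_child[OF m'])
      then show ?thesis using child_parent_unique[OF m] m' xy 1 by auto
    qed (use eq xy in \<open>auto simp: e_def\<close>)
  qed
  moreover have "e ` taken s \<subseteq> UNIV \<times> (node_set - {top_node})"
  proof (rule image_subsetI)
    fix x assume "x \<in> taken s"
    then obtain n a where x: "x = (n, a)" and t: "(n, a) \<in> taken s" by (metis surj_pair)
    show "e x \<in> UNIV \<times> (node_set - {top_node})"
    proof (cases a)
      case (Down i)
      then obtain m where m: "child n i m" using t reachable_taken_child[OF assms] by blast
      then show ?thesis using Down x child_nodes[OF m] child_not_root[OF m]
        by (auto simp: e_def the_child[OF m])
    next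
      case Up
      then show ?thesis using t x reachable_taken_Up[OF assms] by (auto simp: e_def)
    qed
  qed
  ultimately have "card (taken s) \<le> card ((UNIV :: bool set) \<times> (node_set - {top_node}))"
    by (metis card_inj_on_le finite_Diff finite_SigmaI finite_code List.finite_set)
  also have "\<dots> = 2 * (card node_set - 1)" using root_V by (simp add: card_cartesian_product)
  finally show ?thesis using card_taken[OF assms] card_V by linarith
qed

text \<open>Only internal nodes have an \<open>i\<close>-th child, and each of them has \<open>k\<close> children.\<close>

lemma reachable_card_down:
  assumes "reachable N \<Phi> s"
  shows "card {n. (n, Down i) \<in> taken s} * k \<le> N"
proof -
  let ?D = "{n. (n, Down i) \<in> taken s}"
  define f where "f = (\<lambda>(n, j). THE m. child n j m)"
  have f: "child n j (f (n, j))" if n: "n \<in> ?D" and j: "j \<in> {1..k}" for n j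
  proof -
    obtain m where m: "child n i m" using reachable_taken_child[OF assms] n by blast
    then have "n \<in> node_set" "\<not> is_leaf T n" using child_nodes leaf_no_child by blast+
    then obtain m' where "child n j m'" using child_exists j by blast
    then show ?thesis by (simp add: f_def the_child)
  qed
  have "inj_on f (?D \<times> {1..k})"
  proof (rule inj_onI, clarify)
    fix n j n' j' assume "(n, Down i) \<in> taken s" "j \<in> {1..k}" "(n', Down i) \<in> taken s" "j' \<in> {1..k}"
      and "f (n, j) = f (n', j')"
    then show "n = n' \<and> j = j'"
      using child_parent_unique[OF f[of n j], of n' j'] f[of n' j'] by auto
  qed
  moreover have "f ` (?D \<times> {1..k}) \<subseteq> node_set" using f child_nodes(2) by blast
  ultimately have "card (?D \<times> {1..k}) \<le> card node_set" by (meson card_inj_on_le List.finite_set)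
  then show ?thesis using card_V by (simp add: card_cartesian_product)
qed

lemma reachable_actions:
  assumes "reachable N \<Phi> s" "(n, a) \<in> taken s"
  shows "a \<in> actions k"
proof (cases a)
  case (Down i)
  then obtain m where "child n i m" using reachable_taken_child[OF assms(1)] assms(2) by blast
  then have "i \<in> {1..k}" by (rule child_index)
  then show ?thesis using Down by (simp add: actions_def)
qed (simp add: actions_def)

section \<open>Depth-first search and its success probability\<close>

lemma unvisited_children_eq:
  assumes "reachable N \<Phi> s"
  shows "unvisited_children \<Phi> s = {i. (\<exists>m. child (cur_node s) i m) \<and> (cur_node s, Down i) \<notin> taken s}"
proof (rule Set.set_eqI)
  fix i
  show "i \<in> unvisited_children \<Phi> s \<longleftrightarrow>
    i \<in> {i. (\<exists>m. child (cur_node s) i m) \<and> (cur_node s, Down i) \<notin> taken s}"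
  proof (cases "\<exists>m. child (cur_node s) i m")
    case True
    then obtain m where m: "child (cur_node s) i m" by blast
    then have "child (cur_node s) i = (\<lambda>m'. m' = m)" using child_unique by blast
    then show ?thesis
      using reachable_child_taken_iff[OF assms m] by (simp add: unvisited_children_def T_def[symmetric])
  qed (simp add: unvisited_children_def T_def[symmetric])
qed

lemma unvisited_children_nonleaf:
  assumes "reachable N \<Phi> s" "\<not> is_leaf T (cur_node s)"
  shows "unvisited_children \<Phi> s = {i \<in> {1..k}. (cur_node s, Down i) \<notin> taken s}"
proof -
  have "(\<exists>m. child (cur_node s) i m) \<longleftrightarrow> i \<in> {1..k}" for i
    using child_exists[OF reachable_cur_V[OF assms(1)] assms(2), of i] child_index[of "cur_node s" i]
    by metis
  then show ?thesis by (simp add: unvisited_children_eq[OF assms(1)])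
qed

lemma unvisited_children_leaf:
  "is_leaf T (cur_node s) \<Longrightarrow> unvisited_children \<Phi> s = {}"
  using leaf_no_child by (auto simp: unvisited_children_def T_def[symmetric])

text \<open>The discipline of a depth-first search: a node is left upwards only after all its
  children were visited. Arbitrary reachable states may violate it, so it is carried along the
  episode separately.\<close>

definition backtracks :: "state \<Rightarrow> bool" where
  "backtracks s \<longleftrightarrow> (\<forall>n i m. (n, Up) \<in> taken s \<longrightarrow> child n i m \<longrightarrow> m \<in> visited s)"

text \<open>At the root, every other visited node has been left upwards, as the root is its own only
  ancestor. If the root had no unvisited child, \<open>backtracks\<close> would spread visitedness
  over the whole tree, including the goal.\<close>

lemma unexplored_root:
  assumes "reachable N \<Phi> s" "\<not> success s" "backtracks s" "cur_node s = top_node"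
  shows "unvisited_children \<Phi> s \<noteq> {}"
proof
  assume empty: "unvisited_children \<Phi> s = {}"
  have root_only: "n = top_node" if "(n, top_node) \<in> (tree_edges T)\<^sup>*" for n
    using that no_edge_to_root by (metis rtranclE)
  have "n \<in> visited s" if "n \<in> node_set" for n
    using that
  proof (induction rule: tree_induct)
    case top_node
    then show ?case using reachable_root_visited[OF assms(1)] .
  next
    case (child n i m)
    show ?case
    proof (cases "n = top_node")
      case True
      then show ?thesis using child empty assms(4) by (auto simp: unvisited_children_def T_def[symmetric])
    next
      case False
      then have "(n, Up) \<in> taken s"
        using reachable_visited_cases[OF assms(1)] child assms(4) root_only by auto
      then show ?thesis using child assms(3) by (auto simp: backtracks_def)
    qed
  qed
  then show False using g_V reachable_visited_goal[OF assms(1,2)] by blast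
qed

lemma backtracks_init: "backtracks (init_state \<Phi>)"
  by (simp add: backtracks_def init_state_simps)

lemma dfs_step:
  assumes s: "reachable N \<Phi> s" "\<not> success s" "backtracks s"
    and a: "if unvisited_children \<Phi> s \<noteq> {} then \<exists>j\<in>unvisited_children \<Phi> s. a = Down j else a = Up"
  shows "legal \<Phi> s a" "reachable N \<Phi> (next_state \<Phi> s a)" "backtracks (next_state \<Phi> s a)"
proof -
  show l: "legal \<Phi> s a"
  proof (cases "unvisited_children \<Phi> s = {}")
    case True
    then have "cur_node s \<noteq> top_node" using unexplored_root[OF s] by auto
    \<comment> \<open>The current node is an ancestor of itself.\<close>
    moreover have "(cur_node s, Up) \<notin> taken s" using reachable_Up_not_ancestor[OF s(1)] by blast
    ultimately show ?thesis using True a by (auto simp: legal_def T_def)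
  next
    case False
    then show ?thesis using a by (auto simp: legal_def unvisited_children_eq[OF s(1)] T_def)
  qed
  \<comment> \<open>Moves never repeat, so the horizon is never what stops an episode.\<close>
  have "cur_step s < horizon N" using reachable_length[OF s(1)] by (simp add: cur_step_def horizon_def)
  then show "reachable N \<Phi> (next_state \<Phi> s a)" using s l by (auto intro: reachable.step)
  have "child (cur_node s) i m \<Longrightarrow> m \<in> visited s" if "a = Up" for i m
    using that a by (auto simp: unvisited_children_def T_def[symmetric] split: if_splits)
  then show "backtracks (next_state \<Phi> s a)"
    using s(3) by (auto simp: backtracks_def next_simps)
qed

text \<open>A union bound over the \<open>2 * N\<close> possible moves: each deviates from the
  search with probability at most \<open>\<delta>\<close>. Which unvisited child the search prefers
  does not matter here.\<close>

lemma success_prob_ge: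
  assumes a: "\<And>s. reachable N \<Phi> s \<Longrightarrow> \<not> success s \<Longrightarrow>
      (if unvisited_children \<Phi> s \<noteq> {} then \<exists>j\<in>unvisited_children \<Phi> s. dfs s = Down j else dfs s = Up)"
    and p: "\<And>s. reachable N \<Phi> s \<Longrightarrow> \<not> success s \<Longrightarrow> pmf (\<pi> s) (dfs s) \<ge> 1 - \<delta>"
    and \<delta>: "0 \<le> \<delta>" "\<delta> \<le> 1"
  shows "success_prob N \<pi> \<Phi> \<ge> 1 - 2 * real N * \<delta>"
proof -
  have "measure_pmf.prob (episode \<Phi> \<pi> m s) {s. success s} \<ge> 1 - real m * \<delta>"
    if "reachable N \<Phi> s" "backtracks s" "2 * N \<le> length (fst s) + m" for m s
    using that
  proof (induction m arbitrary: s)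
    case 0
    \<comment> \<open>The budget cannot be exhausted, because a reachable state has fewer than
      \<open>2 * N\<close> past moves. Hence the search, which is never stuck, must reach the goal,
      and no measure of progress is needed.\<close>
    then show ?case using reachable_length[of s] by simp
  next
    case (Suc m)
    show ?case
    proof (cases "success s")
      case True
      then show ?thesis using \<delta> by (simp add: measure_return_pmf)
    next
      case False
      let ?s' = "next_state \<Phi> s (dfs s)"
      let ?P = "\<lambda>p. measure_pmf.prob p {s. success s}"
      note d = dfs_step[OF Suc.prems(1) False Suc.prems(2) a[OF Suc.prems(1) False]]
      have len: "2 * N \<le> length (fst ?s') + m" using Suc.prems(3) by (simp add: next_state_def)
      have IH: "?P (episode \<Phi> \<pi> m ?s') \<ge> 1 - real m * \<delta>" by (rule Suc.IH[OF d(2,3) len])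
      have "(1 - \<delta>) * (1 - real m * \<delta>) = 1 - real (Suc m) * \<delta> + real m * \<delta>\<^sup>2"
        by (simp add: algebra_simps power2_eq_square)
      then have "1 - real (Suc m) * \<delta> \<le> (1 - \<delta>) * (1 - real m * \<delta>)" by simp
      also have "\<dots> \<le> (1 - \<delta>) * ?P (episode \<Phi> \<pi> m ?s')"
        using IH \<delta> by (intro mult_left_mono) auto
      also have "\<dots> \<le> pmf (\<pi> s) (dfs s) * ?P (episode \<Phi> \<pi> m ?s')"
        using p[OF Suc.prems(1) False] by (intro mult_right_mono) auto
      also have "\<dots> \<le> ?P (episode \<Phi> \<pi> (Suc m) s)"
        using measure_bind_pmf_ge[of "\<pi> s" "dfs s"
            "\<lambda>a. if legal \<Phi> s a then episode \<Phi> \<pi> m (next_state \<Phi> s a) else return_pmf s"] d(1) False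
        by simp
      finally show ?thesis .
    qed
  qed
  from this[OF reachable.init backtracks_init, of "2 * N"] show ?thesis
    by (simp add: success_prob_def horizon_def)
qed

end

section \<open>Logits of the transformer policy\<close>

definition history :: "state \<Rightarrow> (nat \<times> action) list" where
  "history s = map (\<lambda>(ob, a). (fst ob, a)) (fst s)"

lemma set_history: "set (history s) = taken s"
  by (simp add: history_def taken_def)

definition action_index :: "nat \<Rightarrow> action \<Rightarrow> nat" where
  "action_index k a = (case a of Down i \<Rightarrow> i | Up \<Rightarrow> k + 1)"

definition mark_index :: "mark \<Rightarrow> nat" where
  "mark_index c = (case c of Zero \<Rightarrow> 0 | Cross \<Rightarrow> 1 | Check \<Rightarrow> 2)"

text \<open>The leading index 0 is the filler; it shifts the positions of the history by
  one.\<close>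

lemma E_n_eq: "E_n U s = mat_of_cols (dim_row U) (map (col U) (0 # map fst (history s)))"
  by (auto simp: E_n_def history_def emb_node_def comp_def split: prod.splits intro!: arg_cong[where f = "mat_of_cols _"])

lemma E_a_eq: "E_a k V s = mat_of_cols (dim_row V) (map (col V) (0 # map (action_index k \<circ> snd) (history s)))"
  by (auto simp: E_a_def history_def emb_action_def action_index_def comp_def
      split: prod.splits action.splits intro!: arg_cong[where f = "mat_of_cols _"])

lemma emb_mark_eq: "emb_mark Z c = col Z (mark_index c)"
  by (simp add: emb_mark_def mark_index_def split: mark.split)

lemma E_c_eq: "E_c Z s = mat_of_cols (dim_row Z) (map (col Z) (map mark_index (marks s)))"
  by (auto simp: E_c_def marks_def emb_mark_eq comp_def split: prod.splits
      intro!: arg_cong[where f = "mat_of_cols _"])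

text \<open>The softmax mass on the earlier moves \<open>Down i\<close>: the filler weighs
  \<open>exp b0\<close>, a position at the current node \<open>exp b1\<close>, any other
  \<open>exp 0\<close>. Positions may be summed as the set \<open>taken s\<close> because legal
  moves are distinct.\<close>

definition down_weight :: "real \<Rightarrow> real \<Rightarrow> state \<Rightarrow> nat \<Rightarrow> real" where
  "down_weight b0 b1 s i =
     (\<Sum>(n, a)\<in>taken s. if a = Down i then (if n = cur_node s then exp b1 else 1) else 0) /
     (exp b0 + (\<Sum>(n, a)\<in>taken s. if n = cur_node s then exp b1 else 1))"

text \<open>The two nonzero columns of \<open>A_C\<close> are \<open>(\<beta>, - \<beta>, 0)\<close> for \<open>\<beta> = ac0\<close> and
  \<open>\<beta> = - ac1\<close>.\<close>

definition mark_bias :: "real \<Rightarrow> real \<Rightarrow> state \<Rightarrow> real" where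
  "mark_bias c0 c1 s = (if cur_mark s = Zero then c0 else - c1)"

text \<open>The softmax normaliser of the mark attention; \<open>Check\<close> is left out since it
  does not occur before success.\<close>

definition mark_norm :: "real \<Rightarrow> state \<Rightarrow> real" where
  "mark_norm \<beta> s = real (count_list (marks s) Zero) * exp \<beta> + real (count_list (marks s) Cross) * exp (- \<beta>)"

definition zero_weight :: "real \<Rightarrow> state \<Rightarrow> real" where
  "zero_weight \<beta> s = real (count_list (marks s) Zero) * exp \<beta> / mark_norm \<beta> s"

definition cross_weight :: "real \<Rightarrow> state \<Rightarrow> real" where
  "cross_weight \<beta> s = real (count_list (marks s) Cross) * exp (- \<beta>) / mark_norm \<beta> s"

lemma softmax_vec: "softmax (vec n f) = vec n (\<lambda>j. exp (f j) / (\<Sum>i<n. exp (f i)))"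
  by (rule eq_vecI) (simp_all add: softmax_def)

lemma sum_nth_distinct:
  fixes F :: "'a \<Rightarrow> 'b::comm_monoid_add"
  assumes "distinct xs" shows "(\<Sum>j<length xs. F (xs ! j)) = sum F (set xs)"
  using sum.reindex_bij_betw[OF bij_betw_nth[OF assms refl refl], of F] by simp

lemma sum_nth_marks:
  fixes F :: "mark \<Rightarrow> real"
  assumes "Check \<notin> set ms"
  shows "(\<Sum>j<length ms. F (ms ! j)) = real (count_list ms Zero) * F Zero + real (count_list ms Cross) * F Cross"
  using assms
proof (induction ms)
  case (Cons m ms)
  then show ?case
    by (cases m) (simp_all add: sum.lessThan_Suc_shift algebra_simps del: sum.lessThan_Suc)
qed simp

text \<open>Row \<open>i < k\<close> of \<open>A_P\<close> picks out the moves
  \<open>Down (i + 1)\<close>. The filler's column of \<open>A_P\<close> is zero, so the filler only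
  enlarges the normaliser.\<close>

lemma node_attention:
  assumes "embeddings k N d1 d2 d3 U V Z" "parameters k d1 d2 d3 B C P Q"
    and ind: "transpose_mat U * B * U = A_B N b0 b1" "P * V = A_P k ap"
    and hist: "distinct (history s)" "\<And>n a. (n, a) \<in> taken s \<Longrightarrow> n \<in> {1..N} \<and> a \<in> actions k"
    and cur: "cur_node s \<in> {1..N}"
  shows "P * E_a k V s *\<^sub>v softmax (transpose_mat (E_n U s) * B *\<^sub>v emb_node U (cur_node s))
    = vec (k + 1) (\<lambda>i. if i < k then - ap * down_weight b0 b1 s (i + 1) else 0)"
proof -
  have U: "U \<in> carrier_mat d1 (N + 1)" and V: "V \<in> carrier_mat d2 (k + 2)"
    and B: "B \<in> carrier_mat d1 d1" and P: "P \<in> carrier_mat (k + 1) d2"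
    using assms by (auto simp: embeddings_def parameters_def)
  define x where "x = cur_node s"
  let ?h = "history s"
  define ns where "ns = 0 # map fst ?h"
  define as where "as = 0 # map (action_index k \<circ> snd) ?h"
  have len: "length as = length ns" "length ns = Suc (length ?h)" by (simp_all add: as_def ns_def)
  have ns: "set ns \<subseteq> {..<N + 1}" using hist(2) by (force simp: ns_def set_history)
  have as: "set as \<subseteq> {..<k + 2}"
    using hist(2) by (force simp: as_def set_history actions_def action_index_def split: action.splits)
  \<comment> \<open>Nodes are numbered from 1, so the filler's score is \<open>b0\<close> and the
    filler is never mistaken for the current node.\<close>
  have x: "x < N + 1" "x \<noteq> 0" using cur by (auto simp: x_def)
  define f where "f = (\<lambda>j. A_B N b0 b1 $$ (ns ! j, x))"
  define D where "D = exp b0 + (\<Sum>(n, a)\<in>taken s. if n = x then exp b1 else 1)"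
  have D0: "D \<noteq> 0"
    unfolding D_def by (intro less_imp_neq[symmetric] add_pos_nonneg sum_nonneg) auto
  have sc: "transpose_mat (E_n U s) * B *\<^sub>v emb_node U (cur_node s) = vec (length ns) f"
    using attention_scores[OF U B ns x(1)] U
    by (simp add: E_n_eq ns_def[symmetric] emb_node_def x_def ind f_def)
  have f0: "exp (f 0) = exp b0" using x by (simp add: f_def A_B_def ns_def)
  have fS: "exp (f (Suc j)) = (if fst (?h ! j) = x then exp b1 else 1)" if "j < length ?h" for j
  proof -
    have "?h ! j \<in> taken s" using that set_history nth_mem by blast
    then have "fst (?h ! j) \<in> {1..N}" using hist(2)[of "fst (?h ! j)" "snd (?h ! j)"] by simp
    then show ?thesis using that x by (auto simp: f_def A_B_def ns_def)
  qed
  have norm: "(\<Sum>j<length ns. exp (f j)) = D"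
  proof -
    have "(\<Sum>j<length ns. exp (f j)) = exp b0 + (\<Sum>j<length ?h. if fst (?h ! j) = x then exp b1 else 1)"
      using fS by (simp add: len sum.lessThan_Suc_shift f0 del: sum.lessThan_Suc)
    also have "(\<Sum>j<length ?h. if fst (?h ! j) = x then exp b1 else 1)
        = (\<Sum>p\<in>taken s. if fst p = x then exp b1 else 1)"
      using sum_nth_distinct[OF hist(1), of "\<lambda>p. if fst p = x then exp b1 else 1"] by (simp add: set_history)
    finally show ?thesis by (simp add: D_def case_prod_unfold)
  qed
  have "(\<Sum>j<length as. A_P k ap $$ (i, as ! j) * (exp (f j) / D))
      = (if i < k then - ap * down_weight b0 b1 s (i + 1) else 0)" if i: "i < k + 1" for i
  proof -
    let ?g = "\<lambda>p. if snd p = Down (i + 1) then (if fst p = x then exp b1 else 1) else 0 :: real"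
    let ?m = "if i < k then - ap else 0"
    have step: "A_P k ap $$ (i, as ! Suc j) * (exp (f (Suc j)) / D) = ?m / D * ?g (?h ! j)"
      if "j < length ?h" for j
    proof -
      have "?h ! j \<in> taken s" using that set_history nth_mem by blast
      then have "snd (?h ! j) \<in> actions k" using hist(2)[of "fst (?h ! j)" "snd (?h ! j)"] by simp
      then have "A_P k ap $$ (i, as ! Suc j) = (if snd (?h ! j) = Down (i + 1) then ?m else 0)"
        using i that by (auto simp: A_P_def as_def actions_def action_index_def)
      then show ?thesis using fS[OF that] by simp
    qed
    have "as ! 0 = 0" by (simp add: as_def)
    then have "(\<Sum>j<length as. A_P k ap $$ (i, as ! j) * (exp (f j) / D))
        = A_P k ap $$ (i, 0) * (exp b0 / D)
          + (\<Sum>j<length ?h. A_P k ap $$ (i, as ! Suc j) * (exp (f (Suc j)) / D))"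
      by (simp only: len sum.lessThan_Suc_shift f0)
    also have "(\<Sum>j<length ?h. A_P k ap $$ (i, as ! Suc j) * (exp (f (Suc j)) / D))
        = (\<Sum>j<length ?h. ?m / D * ?g (?h ! j))"
      using step by (intro sum.cong) auto
    also have "A_P k ap $$ (i, 0) = 0" using i by (simp add: A_P_def)
    also have "(\<Sum>j<length ?h. ?m / D * ?g (?h ! j)) = ?m / D * (\<Sum>p\<in>taken s. ?g p)"
      by (simp only: sum_distrib_left[symmetric] sum_nth_distinct[OF hist(1), of ?g] set_history)
    also have "(\<Sum>p\<in>taken s. ?g p) = down_weight b0 b1 s (i + 1) * D"
      using D0 unfolding down_weight_def D_def x_def case_prod_unfold by simp
    also have "0 * (exp b0 / D) + ?m / D * (down_weight b0 b1 s (i + 1) * D)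
        = (if i < k then - ap * down_weight b0 b1 s (i + 1) else 0)"
      using D0 by simp
    finally show ?thesis .
  qed
  moreover have "P * E_a k V s *\<^sub>v softmax (vec (length ns) f)
      = vec (k + 1) (\<lambda>i. \<Sum>j<length as. A_P k ap $$ (i, as ! j) * (exp (f j) / D))"
    using attention_values[OF P V as, of "softmax (vec (length ns) f)"] V
    unfolding E_a_eq as_def[symmetric] by (simp add: softmax_vec norm[unfolded len] ind len del: sum.lessThan_Suc)
  ultimately show ?thesis unfolding sc by (intro eq_vecI) simp_all
qed

text \<open>Without \<open>Check\<close> the current mark selects one of the two nonzero columns of
  \<open>A_C\<close>, and both are covered by \<open>mark_bias\<close>.\<close>

lemma mark_attention:
  assumes "embeddings k N d1 d2 d3 U V Z" "parameters k d1 d2 d3 B C P Q"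
    and ind: "transpose_mat Z * C * Z = A_C c0 c1" "Q * Z = A_Q k lam q0 qx"
    and check: "Check \<notin> set (marks s)"
  defines "\<beta> \<equiv> mark_bias c0 c1 s"
  shows "Q * E_c Z s *\<^sub>v softmax (transpose_mat (E_c Z s) * C *\<^sub>v emb_mark Z (cur_mark s))
    = vec (k + 1) (\<lambda>i. if i < k then lam (i + 1) * zero_weight \<beta> s
        else - q0 * zero_weight \<beta> s + qx * cross_weight \<beta> s)"
proof -
  have Z: "Z \<in> carrier_mat d3 3" and C: "C \<in> carrier_mat d3 d3" and Q: "Q \<in> carrier_mat (k + 1) d3"
    using assms by (auto simp: embeddings_def parameters_def)
  let ?ms = "marks s"
  have ms: "set (map mark_index ?ms) \<subseteq> {..<3}"
    by (auto simp: mark_index_def split: mark.splits)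
  define y where "y = mark_index (cur_mark s)"
  have y: "y < 3" by (simp add: y_def mark_index_def split: mark.splits)
  define e where "e = (\<lambda>c. exp (A_C c0 c1 $$ (mark_index c, y)))"
  have cur: "cur_mark s = Zero \<or> cur_mark s = Cross"
    using check by (cases "cur_mark s") (auto simp: marks_def)
  have e: "e Zero = exp \<beta>" "e Cross = exp (- \<beta>)"
    using cur by (auto simp: e_def y_def \<beta>_def mark_bias_def A_C_def mark_index_def mat_of_rows_list_def)
  have norm: "(\<Sum>j<length ?ms. e (?ms ! j)) = mark_norm \<beta> s"
    using sum_nth_marks[OF check, of e] by (simp add: e mark_norm_def)
  have sm: "softmax (transpose_mat (E_c Z s) * C *\<^sub>v emb_mark Z (cur_mark s))
      = vec (length ?ms) (\<lambda>j. e (?ms ! j) / mark_norm \<beta> s)"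
    using attention_scores[OF Z C ms y] Z norm
    by (simp add: E_c_eq emb_mark_eq y_def[symmetric] ind softmax_vec) (auto simp: e_def intro!: eq_vecI)
  have "(\<Sum>j<length ?ms. A_Q k lam q0 qx $$ (i, mark_index (?ms ! j)) * (e (?ms ! j) / mark_norm \<beta> s))
      = (if i < k then lam (i + 1) * zero_weight \<beta> s
          else - q0 * zero_weight \<beta> s + qx * cross_weight \<beta> s)" if "i < k + 1" for i
    using sum_nth_marks[OF check, of "\<lambda>c. A_Q k lam q0 qx $$ (i, mark_index c) * (e c / mark_norm \<beta> s)"] that
    by (cases "i < k") (simp_all add: e A_Q_def mark_index_def zero_weight_def cross_weight_def mult_ac)
  moreover have "Q * E_c Z s *\<^sub>v vec (length ?ms) (\<lambda>j. e (?ms ! j) / mark_norm \<beta> s)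
      = vec (k + 1) (\<lambda>i. \<Sum>j<length ?ms.
          A_Q k lam q0 qx $$ (i, mark_index (?ms ! j)) * (e (?ms ! j) / mark_norm \<beta> s))"
    using attention_values[OF Q Z ms, of "vec (length ?ms) (\<lambda>j. e (?ms ! j) / mark_norm \<beta> s)"] Z
    by (simp add: E_c_eq ind)
  ultimately show ?thesis unfolding sm by (intro eq_vecI) simp_all
qed

section \<open>From softmax margins to distances of policies\<close>

lemma softmax_nonneg: "j < dim_vec x \<Longrightarrow> 0 \<le> softmax x $ j"
  by (simp add: softmax_def sum_nonneg)

lemma softmax_sum: assumes "0 < dim_vec x" shows "(\<Sum>j<dim_vec x. softmax x $ j) = 1"
proof -
  have "(\<Sum>j<dim_vec x. exp (x $ j)) > 0" using assms by (intro sum_pos) auto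
  then show ?thesis by (simp add: softmax_def sum_divide_distrib[symmetric])
qed

text \<open>Each of the other coordinates has at most \<open>exp (- D)\<close> times the weight of
  coordinate \<open>t\<close>.\<close>

lemma softmax_margin:
  assumes t: "t < dim_vec x" and D: "\<And>j. j < dim_vec x \<Longrightarrow> j \<noteq> t \<Longrightarrow> x $ j + D \<le> x $ t"
  shows "softmax x $ t \<ge> 1 - real (dim_vec x - 1) * exp (- D)"
proof -
  let ?S = "\<Sum>j<dim_vec x. exp (x $ j)"
  let ?R = "\<Sum>j\<in>{..<dim_vec x} - {t}. exp (x $ j)"
  have S: "?S = exp (x $ t) + ?R" using t by (subst sum.remove[of _ t]) auto
  have R: "0 \<le> ?R" by (simp add: sum_nonneg)
  have "?R \<le> (\<Sum>j\<in>{..<dim_vec x} - {t}. exp (x $ t) * exp (- D))"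
  proof (rule sum_mono)
    fix j assume "j \<in> {..<dim_vec x} - {t}"
    then have "x $ j \<le> x $ t + - D" using D[of j] by auto
    then show "exp (x $ j) \<le> exp (x $ t) * exp (- D)" by (metis exp_add exp_le_cancel_iff)
  qed
  also have "\<dots> = real (dim_vec x - 1) * exp (- D) * exp (x $ t)" using t by simp
  also have "\<dots> \<le> real (dim_vec x - 1) * exp (- D) * ?S" using S R by (intro mult_left_mono) auto
  finally have "?R \<le> real (dim_vec x - 1) * exp (- D) * ?S" .
  moreover have "?S > 0" using S R by (simp add: add_pos_nonneg)
  moreover have "softmax x $ t = 1 - ?R / ?S" using t S \<open>?S > 0\<close> by (simp add: softmax_def field_simps)
  ultimately show ?thesis by (simp add: divide_le_eq)
qed

text \<open>\<open>embed_pmf\<close> reproduces its argument only if that is nonnegative with total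
  mass 1, which the softmax guarantees.\<close>

lemma transformer_policy_pmf:
  assumes x: "transformer_probs k U V Z B C P Q s = softmax x" "dim_vec x = k + 1"
  shows "pmf (transformer_policy k U V Z B C P Q s) a = (case a of
       Down i \<Rightarrow> if i \<in> {1..k} then softmax x $ (i - 1) else 0 | Up \<Rightarrow> softmax x $ k)"
proof -
  let ?f = "\<lambda>a. case a of Down i \<Rightarrow> if i \<in> {1..k} then softmax x $ (i - 1) else 0 | Up \<Rightarrow> softmax x $ k"
  have nn: "0 \<le> ?f a" for a
    using x(2) by (auto simp: softmax_nonneg split: action.splits)
  have "(\<Sum>a\<in>actions k. ?f a) = softmax x $ k + (\<Sum>i\<in>{1..k}. softmax x $ (i - 1))"
    by (subst actions_def, subst sum.insert) (auto simp: sum.reindex inj_on_def)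
  also have "(\<Sum>i\<in>{1..k}. softmax x $ (i - 1)) = (\<Sum>j<k. softmax x $ j)"
    by (rule sum.reindex_bij_witness[of _ Suc "\<lambda>i. i - 1"]) auto
  also have "softmax x $ k + \<dots> = 1" using softmax_sum[of x] x(2) by simp
  finally have s: "(\<Sum>a\<in>actions k. ?f a) = 1" .
  have "(\<integral>\<^sup>+a. ennreal (?f a) \<partial>count_space UNIV) = (\<Sum>a\<in>actions k. ennreal (?f a))"
    by (rule nn_integral_count_space') (auto simp: actions_def split: action.splits)
  also have "\<dots> = 1" using nn s by (simp add: sum_ennreal)
  finally have "pmf (embed_pmf ?f) a = ?f a" by (intro pmf_embed_pmf nn)
  then show ?thesis unfolding transformer_policy_def x(1) .
qed

text \<open>Mass \<open>q\<close> on \<open>b\<close> bounds the defect at \<open>b\<close> as well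
  as the mass of any other action.\<close>

lemma sup_dist_return:
  assumes q: "q \<le> pmf p b" and b: "b \<in> actions k"
  shows "sup_dist k p (return_pmf b) \<le> 1 - q"
proof -
  have "\<bar>pmf p a - pmf (return_pmf b) a\<bar> \<le> 1 - q" for a
  proof (cases "a = b")
    case True
    then show ?thesis using q pmf_le_1[of p b] by simp
  next
    case False
    have "pmf p a + pmf p b = measure_pmf.prob p {a, b}"
      using False by (subst measure_measure_pmf_finite) auto
    also have "\<dots> \<le> 1" by simp
    finally show ?thesis using q False by (simp add: pmf_nonneg)
  qed
  moreover have "finite (actions k)" by (simp add: actions_def)
  ultimately show ?thesis using b unfolding sup_dist_def by (subst Max_le_iff) auto
qed

section \<open>Margins in the trained regime\<close>

text \<open>As \<open>p\<close> decreases, its maximum over \<open>S\<close> is attained at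
  \<open>Min S\<close>; from here on only the order of the indices matters.\<close>

lemma arg_max_least:
  assumes p: "branch_probs k p" and S: "S \<subseteq> {1..k}" "S \<noteq> {}"
  shows "arg_max p (\<lambda>j. j \<in> S) \<in> S" "\<And>j. j \<in> S \<Longrightarrow> arg_max p (\<lambda>j. j \<in> S) \<le> j"
proof -
  have dec: "p j < p i" if "1 \<le> i" "i < j" "j \<le> k" for i j
    using that(2,3)
  proof (induction j)
    case (Suc j)
    have "p (Suc j) < p j" using p that(1) Suc.prems by (auto simp: branch_probs_def)
    then show ?case using Suc by (cases "i = j") auto
  qed simp
  have fin: "finite S" using S finite_subset by blast
  have "arg_max p (\<lambda>j. j \<in> S) = Min S"
  proof (rule arg_maxI[of "\<lambda>j. j \<in> S" "Min S"])
    show "Min S \<in> S" using fin S by simp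
    show "\<not> p j > p (Min S)" if "j \<in> S" for j
    proof (cases "j = Min S")
      case False
      then have "Min S < j" using fin that by (simp add: order.strict_iff_order)
      then show ?thesis using dec[of "Min S" j] S fin that Min_in[OF fin S(2)] by force
    qed simp
    show "j = Min S" if j: "j \<in> S" "\<forall>y. y \<in> S \<longrightarrow> \<not> p y > p j" for j
    proof (rule ccontr)
      assume "j \<noteq> Min S"
      then have "Min S < j" using fin j by (simp add: order.strict_iff_order)
      then show False using dec[of "Min S" j] S fin j Min_in[OF fin S(2)] by force
    qed
  qed
  then show "arg_max p (\<lambda>j. j \<in> S) \<in> S" "\<And>j. j \<in> S \<Longrightarrow> arg_max p (\<lambda>j. j \<in> S) \<le> j"
    using fin S by simp_all
qed

text \<open>The condition on \<open>exp b1\<close> contains the plain \<open>ln k\<close> without an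
  absolute floor; this bounds that factor from below.\<close>

lemma half_le_ln: assumes "2 \<le> k" shows "1 / 2 \<le> ln (real k)"
proof -
  have "1 / 2 \<le> ln (2::real)" using ln2_ge_two_thirds by simp
  also have "\<dots> \<le> ln (real k)" using assms by simp
  finally show ?thesis .
qed

text \<open>\<open>F\<close> stands for \<open>ln_floor C1 k\<close>. Its bounds
  \<open>16 * K / c\<close> and \<open>4 * K / c\<^sup>2\<close> keep the noise from other nodes
  below \<open>q0 / 16\<close> and \<open>c * q0 / 4\<close>; the first also controls the
  \<open>Down\<close> logits at a leaf. The bound \<open>4 / c\<close> keeps the weaker mark term of
  the \<open>Up\<close> logit below a quarter of the stronger one.\<close>

locale trained = kary_env +
  fixes \<epsilon> c K F l b0 b1 c0 c1 q0 qx ap :: real and lam :: "nat \<Rightarrow> real"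
  defines "K \<equiv> 1 / c + 1 / c\<^sup>2" and "l \<equiv> ln (real N / \<epsilon>)"
  assumes eps: "0 < \<epsilon>" "\<epsilon> \<le> 1" and Nk: "k < N" and c: "0 < c"
    and F: "16 * K / c \<le> F" "4 * K / c\<^sup>2 \<le> F" "4 / c \<le> F" "2 \<le> F"
    and c0: "F \<le> exp c0" and c1: "sqrt (real N * real k) * F \<le> exp c1"
    and b0: "real N * real k * F \<le> exp b0" and b1: "ln (real k) * exp b0 \<le> exp b1"
    and gap_ge: "\<And>i. i \<in> {1..<k} \<Longrightarrow> c * q0 \<le> lam i - lam (Suc i)"
    and gap_le: "\<And>i. i \<in> {1..<k} \<Longrightarrow> c * (lam i - lam (Suc i)) \<le> q0"
    and gap_ln: "\<And>i. i \<in> {1..<k} \<Longrightarrow> 32 * l \<le> lam i - lam (Suc i)"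
    and q: "c * qx \<le> q0" "c * q0 \<le> qx" "32 * l \<le> q0" "32 * l \<le> qx"
    and lam_k: "c * lam k \<le> qx" "0 \<le> lam k"
    and ap: "c * (ap / real k) \<le> lam 1" "32 * (l + q0 + lam 1) \<le> ap / real k"
begin

section \<open>Bounds on the ranking scores\<close>

lemma K_pos: "0 < K" using c by (simp add: K_def add_pos_pos)
lemma F_pos: "0 < F" using F(4) by simp
lemma l_nonneg: "0 \<le> l" using eps Nk k2 by (simp add: l_def ln_ge_zero divide_simps)
lemma q_nonneg: "0 \<le> q0" "0 \<le> qx" using q l_nonneg by linarith+

lemma lam_antimono: assumes "1 \<le> i" "i \<le> j" "j \<le> k" shows "lam j \<le> lam i"
  using assms(2,3)
proof (induction j rule: dec_induct)
  case (step j)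
  then have "32 * l \<le> lam j - lam (Suc j)" using gap_ln[of j] assms(1) by simp
  then show ?case using step l_nonneg by simp
qed simp

lemma lam_nonneg: "1 \<le> i \<Longrightarrow> i \<le> k \<Longrightarrow> 0 \<le> lam i"
  using lam_antimono[of i k] lam_k(2) by simp

lemma lam_gap: assumes "1 \<le> i" "i < j" "j \<le> k"
  shows "c * q0 \<le> lam i - lam j" "32 * l \<le> lam i - lam j"
  using gap_ge[of i] gap_ln[of i] lam_antimono[of "Suc i" j] assms by auto

text \<open>Telescoping: \<open>lam 1\<close> exceeds \<open>lam k\<close> by \<open>k - 1\<close>
  gaps of size at most \<open>q0 / c\<close>, and \<open>lam k\<close> is at most
  \<open>qx / c\<close>, hence at most \<open>q0 / c\<^sup>2\<close>. This is the origin of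
  \<open>K\<close>.\<close>

lemma lam_1_le: "lam 1 \<le> real k * K * q0"
proof -
  have "lam i \<le> lam k + real (k - i) * (q0 / c)" if "i \<le> k" "1 \<le> i" for i
    using that
  proof (induction i rule: inc_induct)
    case (step i)
    have "lam i - lam (Suc i) \<le> q0 / c" using gap_le[of i] step c by (simp add: pos_le_divide_eq mult.commute)
    moreover have "real (k - i) = real (k - Suc i) + 1" using step by simp
    then have "real (k - i) * (q0 / c) = real (k - Suc i) * (q0 / c) + q0 / c"
      by (simp only: distrib_right mult_1)
    moreover have "lam (Suc i) \<le> lam k + real (k - Suc i) * (q0 / c)" using step by simp
    ultimately show ?case by linarith
  qed simp
  from this[of 1] have "lam 1 \<le> lam k + real (k - 1) * (q0 / c)" using k2 by simp
  also have "lam k \<le> q0 / c\<^sup>2"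
  proof -
    have "lam k \<le> qx / c" using lam_k c by (simp add: pos_le_divide_eq mult.commute)
    also have "\<dots> \<le> q0 / c / c" using q(1) c by (intro divide_right_mono) (simp_all add: pos_le_divide_eq mult.commute)
    finally show ?thesis by (simp add: power2_eq_square)
  qed
  also have "q0 / c\<^sup>2 \<le> real k * (q0 / c\<^sup>2)" 
    using mult_right_mono[of 1 "real k" "q0 / c\<^sup>2"] q_nonneg k2 by simp
  also have "real (k - 1) * (q0 / c) \<le> real k * (q0 / c)" using q_nonneg c by (intro mult_right_mono) auto
  finally show ?thesis by (simp add: K_def algebra_simps)
qed

lemma lam_1_nonneg: "0 \<le> lam 1" using lam_nonneg k2 by simp

lemma ap_nonneg: "0 \<le> ap"
proof -
  have "0 \<le> 32 * (l + q0 + lam 1)" using l_nonneg q_nonneg lam_1_nonneg by simp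
  also note ap(2)
  finally have "0 \<le> ap / real k" .
  then show ?thesis using k2 by (simp add: zero_le_divide_iff)
qed

section \<open>Attention weights of moves and marks\<close>

lemma down_weight_nonneg: "0 \<le> down_weight b0 b1 s i"
  unfolding down_weight_def by (intro divide_nonneg_nonneg add_nonneg_nonneg sum_nonneg) auto

text \<open>Only other nodes contribute, at most \<open>N / k\<close> of them with weight 1 each,
  over a normaliser of at least \<open>N * k * F\<close>. As \<open>ap\<close> is at most
  \<open>k * lam 1 / c\<close>, hence at most \<open>k\<^sup>2 * K * q0 / c\<close>, the powers of
  \<open>k\<close> cancel and \<open>K / c / F * q0\<close> remains.\<close>

lemma down_weight_fresh:
  assumes s: "reachable N \<Phi> s" and i: "(cur_node s, Down i) \<notin> taken s"
  shows "ap * down_weight b0 b1 s i \<le> q0 / 16" "ap * down_weight b0 b1 s i \<le> c * q0 / 4"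
proof -
  let ?D = "{n. (n, Down i) \<in> taken s}"
  let ?Z = "\<Sum>(n, a)\<in>taken s. if n = cur_node s then exp b1 else (1::real)"
  have k: "real k > 0" "real N > 0" using k2 Nk by simp_all
  have "(\<Sum>(n, a)\<in>taken s. if a = Down i then (if n = cur_node s then exp b1 else 1) else (0::real))
      = (\<Sum>p\<in>taken s. if p \<in> {p \<in> taken s. snd p = Down i} then 1 else 0)"
    using i by (intro sum.cong) auto
  also have "\<dots> = real (card {p \<in> taken s. snd p = Down i})"
    using finite_taken[of s] by (simp add: sum.If_cases Int_def)
  also have "{p \<in> taken s. snd p = Down i} = (\<lambda>n. (n, Down i)) ` ?D" by force
  also have "card \<dots> = card ?D" by (intro card_image inj_onI) auto
  also have "real (card ?D) \<le> real N / real k"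
    using reachable_card_down[OF s, of i] k by (simp add: pos_le_divide_eq flip: of_nat_mult)
  finally have num: "(\<Sum>(n, a)\<in>taken s. if a = Down i then (if n = cur_node s then exp b1 else 1) else (0::real))
      \<le> real N / real k" .
  have "?Z \<ge> 0" by (intro sum_nonneg) auto
  then have den: "real N * real k * F \<le> exp b0 + ?Z" using b0 by simp
  have "down_weight b0 b1 s i \<le> (real N / real k) / (real N * real k * F)"
    unfolding down_weight_def using k F_pos by (intro frac_le num den) auto
  also have "\<dots> = 1 / (real k * real k * F)" using k by simp
  finally have "ap * down_weight b0 b1 s i \<le> ap * (1 / (real k * real k * F))"
    using ap_nonneg by (intro mult_left_mono)
  also have "\<dots> = (ap / real k) / (real k * F)" by simp
  also have "\<dots> \<le> (lam 1 / c) / (real k * F)"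
    using ap(1) c k F_pos by (intro divide_right_mono) (simp_all add: pos_le_divide_eq mult.commute)
  also have "\<dots> \<le> (real k * K * q0 / c) / (real k * F)"
    using lam_1_le c k F_pos by (intro divide_right_mono) auto
  also have "\<dots> = K / c / F * q0" using k by simp
  finally have *: "ap * down_weight b0 b1 s i \<le> K / c / F * q0" .
  have "K / c \<le> 1 / 16 * F" using F(1) c by (simp add: field_simps)
  then have "K / c / F \<le> 1 / 16" using F_pos by (simp only: pos_divide_le_eq)
  then have "K / c / F * q0 \<le> 1 / 16 * q0" using q_nonneg by (intro mult_right_mono)
  with * show "ap * down_weight b0 b1 s i \<le> q0 / 16" by linarith
  have "K / c / F \<le> c / 4" using F(2) F_pos c by (simp add: field_simps power2_eq_square)
  then have "K / c / F * q0 \<le> c / 4 * q0" using q_nonneg by (intro mult_right_mono)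
  with * show "ap * down_weight b0 b1 s i \<le> c * q0 / 4" by linarith
qed

text \<open>At most \<open>k + 1\<close> moves of weight \<open>exp b1\<close> were made at the
  current node. The up to \<open>2 * N\<close> other moves and the filler add at most
  \<open>2 * exp b1\<close> each, so the normaliser is at most \<open>(k + 5) * exp b1\<close>, and
  \<open>k + 5 \<le> 4 * k\<close>.\<close>

lemma down_weight_taken:
  assumes s: "reachable N \<Phi> s" and i: "(cur_node s, Down i) \<in> taken s"
  shows "ap / real k / 4 \<le> ap * down_weight b0 b1 s i"
proof -
  let ?Y = "\<Sum>(n, a)\<in>taken s. if a = Down i then (if n = cur_node s then exp b1 else 1) else (0::real)"
  let ?Z = "\<Sum>(n, a)\<in>taken s. if n = cur_node s then exp b1 else (1::real)"
  let ?A = "{p \<in> taken s. fst p = cur_node s}"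
  have k: "real k \<ge> 2" "real N > 0" using k2 Nk by simp_all
  have "exp b1 = (case (cur_node s, Down i) of (n, a) \<Rightarrow>
      if a = Down i then (if n = cur_node s then exp b1 else 1) else (0::real))" by simp
  also have "\<dots> \<le> ?Y" using finite_taken[of s] by (intro member_le_sum i) (simp_all add: split_beta)
  finally have num: "exp b1 \<le> ?Y" .
  \<comment> \<open>Every move is charged an extra 1, so that the moves at other nodes need not be
    counted separately.\<close>
  have "?Z \<le> (\<Sum>p\<in>taken s. (if p \<in> ?A then exp b1 else 0) + 1)"
    by (intro sum_mono) auto
  also have "\<dots> = real (card ?A) * exp b1 + real (card (taken s))"
    using finite_taken[of s] by (simp add: sum.distrib sum.If_cases Int_def)
  also have "card ?A = card (snd ` ?A)" by (intro card_image[symmetric] inj_onI) (auto simp: prod_eq_iff)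
  also have "\<dots> \<le> card (actions k)"
  proof (rule card_mono)
    show "snd ` ?A \<subseteq> actions k" using reachable_actions[OF s] by auto
  qed (simp add: actions_def)
  also have "card (actions k) = k + 1"
    by (subst actions_def, subst card_insert_disjoint) (auto simp: card_image inj_on_def)
  also have "card (taken s) \<le> 2 * N" using card_taken[OF s] reachable_length[OF s] by simp
  finally have Z: "?Z \<le> real (k + 1) * exp b1 + real (2 * N)" by simp
  have b: "exp b0 \<le> 2 * exp b1"
  proof -
    have "1 / 2 * exp b0 \<le> ln (real k) * exp b0" using half_le_ln[OF k2] by (intro mult_right_mono) auto
    then show ?thesis using b1 by linarith
  qed
  have "2 * real N \<le> real N * real k * F"
    using k F(4) mult_mono[of 2 "real k" 1 F] mult_left_mono[of 2 "real k * F" "real N"] by (simp add: mult_ac)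
  then have "real (2 * N) \<le> 2 * exp b1" using b0 b by simp
  then have "exp b0 + ?Z \<le> (real k + 5) * exp b1" using Z b by (simp add: algebra_simps)
  also have "\<dots> \<le> (4 * real k) * exp b1" using k by (intro mult_right_mono) auto
  finally have den: "exp b0 + ?Z \<le> 4 * real k * exp b1" .
  have Z0: "0 < exp b0 + ?Z" by (intro add_pos_nonneg sum_nonneg) auto
  have "1 / (4 * real k) = exp b1 / (4 * real k * exp b1)" by simp
  also have "\<dots> \<le> down_weight b0 b1 s i"
    unfolding down_weight_def by (intro frac_le num den Z0 sum_nonneg) auto
  finally have "ap * (1 / (4 * real k)) \<le> ap * down_weight b0 b1 s i"
    using ap_nonneg by (intro mult_left_mono)
  then show ?thesis by simp
qed

abbreviation "\<beta> \<equiv> mark_bias c0 c1"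

text \<open>Crosses do not outnumber zeros, so with bias \<open>c0\<close> the ratio of
  \<open>w\<close> to \<open>z\<close> is at most \<open>exp (- (2 * c0))\<close>, hence at most
  \<open>1 / F\<close>.\<close>

lemma mark_weights_inner:
  assumes s: "reachable N \<Phi> s" "\<not> success s" and nl: "\<not> is_leaf T (cur_node s)"
  defines "z \<equiv> zero_weight (\<beta> s) s" and "w \<equiv> cross_weight (\<beta> s) s"
  shows "z + w = 1" "0 \<le> w" "1 / 2 \<le> z" "w \<le> z / F"
proof -
  have "cur_mark s = snd (observe \<Phi> (cur_node s))" by (simp add: cur_mark_def reachable_obs[OF s(1)])
  then have \<beta>: "\<beta> s = c0" using nl by (simp add: mark_bias_def observe_def T_def)
  define nz nc where "nz = real (count_list (marks s) Zero)" and "nc = real (count_list (marks s) Cross)"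
  have n: "nc \<le> nz" "1 \<le> nz" "0 \<le> nc"
    using reachable_cross_le_zero[OF s(1)] nl by (auto simp: nz_def nc_def)
  define D where "D = mark_norm c0 s"
  have D: "D = nz * exp c0 + nc * exp (- c0)" by (simp add: D_def mark_norm_def nz_def nc_def)
  have D0: "0 < D" unfolding D using n by (intro add_pos_nonneg mult_pos_pos) auto
  have zw: "z = nz * exp c0 / D" "w = nc * exp (- c0) / D"
    by (simp_all add: z_def w_def zero_weight_def cross_weight_def nz_def nc_def D_def[symmetric] \<beta>)
  show 1: "z + w = 1" using D0 by (simp add: zw D add_divide_distrib[symmetric])
  show "0 \<le> w" using n D0 by (simp add: zw)
  have "exp (- c0) * F \<le> 1" using c0 by (simp add: exp_minus field_simps)
  also have "1 \<le> exp c0" using c0 F(4) by linarith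
  finally have "nc * (exp (- c0) * F) \<le> nz * exp c0" using n by (intro mult_mono) (use F_pos in auto)
  then show 2: "w \<le> z / F" using D0 F_pos by (simp add: zw field_simps)
  have "0 \<le> z" using n D0 by (simp add: zw)
  then have "z / F \<le> z" using F(4) by (simp add: divide_le_eq mult_le_cancel_left1)
  then show "1 / 2 \<le> z" using 1 2 by simp
qed

text \<open>Only the current cross is certain, against up to \<open>2 * N\<close> zeros, so the bias
  must outweigh a factor \<open>N\<close>: \<open>exp (2 * c1)\<close> is at least
  \<open>N * k * F\<close>. The extra factor \<open>k\<close> is spent in
  \<open>logit_margin_up\<close> on scores \<open>lam i\<close> of order
  \<open>k * q0\<close>.\<close>

lemma mark_weights_leaf:
  assumes s: "reachable N \<Phi> s" "\<not> success s" and lf: "is_leaf T (cur_node s)"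
  defines "z \<equiv> zero_weight (\<beta> s) s" and "w \<equiv> cross_weight (\<beta> s) s"
  shows "z + w = 1" "0 \<le> z" "1 / 2 \<le> w" "z * (real k * F) \<le> 2 * w"
proof -
  have "cur_mark s = snd (observe \<Phi> (cur_node s))" by (simp add: cur_mark_def reachable_obs[OF s(1)])
  then have cross: "cur_mark s = Cross"
    using lf s(2) by (simp add: success_def observe_def T_def split: if_splits)
  then have \<beta>: "\<beta> s = - c1" by (simp add: mark_bias_def)
  define nz nc where "nz = real (count_list (marks s) Zero)" and "nc = real (count_list (marks s) Cross)"
  have "count_list (marks s) Zero \<le> length (marks s)" by (rule count_le_length)
  also have "\<dots> \<le> 2 * N" using reachable_length[OF s(1)] by (simp add: marks_def)
  finally have nz: "nz \<le> 2 * real N" "0 \<le> nz" by (simp_all add: nz_def)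
  have nc: "1 \<le> nc" using cross by (simp add: nc_def marks_def)
  define D where "D = mark_norm (- c1) s"
  have D: "D = nz * exp (- c1) + nc * exp c1" by (simp add: D_def mark_norm_def nz_def nc_def)
  have D0: "0 < D" unfolding D using nz nc by (intro add_nonneg_pos mult_pos_pos) auto
  have zw: "z = nz * exp (- c1) / D" "w = nc * exp c1 / D"
    by (simp_all add: z_def w_def zero_weight_def cross_weight_def nz_def nc_def D_def[symmetric] \<beta>)
  show 1: "z + w = 1" using D0 by (simp add: zw D add_divide_distrib[symmetric])
  show z0: "0 \<le> z" using nz D0 by (simp add: zw)
  have k: "real k \<ge> 2" "real N > 0" using k2 Nk by simp_all
  have "real N * real k * F \<le> real N * real k * (F * F)"
    using F(4) k by (intro mult_left_mono) (auto simp: mult_le_cancel_left1)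
  also have "\<dots> = (sqrt (real N * real k) * F) * (sqrt (real N * real k) * F)"
    using real_sqrt_mult_self[of "real N * real k"] by (simp add: algebra_simps del: real_sqrt_mult_self)
  also have "\<dots> \<le> exp c1 * exp c1" using c1 F_pos k by (intro mult_mono) auto
  finally have "exp (- c1) * (real N * real k * F) \<le> exp (- c1) * (exp c1 * exp c1)"
    by (intro mult_left_mono) auto
  also have "\<dots> = exp c1" by (simp add: exp_minus)
  finally have e: "exp (- c1) * (real N * real k * F) \<le> exp c1" .
  have "nz * (exp (- c1) * (real k * F)) \<le> 2 * real N * (exp (- c1) * (real k * F))"
    using nz F_pos by (intro mult_right_mono) auto
  also have "\<dots> \<le> 2 * exp c1" using e by (simp add: mult_ac)
  also have "\<dots> \<le> 2 * (nc * exp c1)" using nc by simp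
  finally have "nz * (exp (- c1) * (real k * F)) / D \<le> 2 * (nc * exp c1) / D"
    using D0 by (intro divide_right_mono) auto
  then show 2: "z * (real k * F) \<le> 2 * w" by (simp add: zw mult_ac)
  have "z * 4 \<le> z * (real k * F)" using z0 k F(4) mult_mono[of 2 "real k" 2 F] by (intro mult_left_mono) auto
  then show "1 / 2 \<le> w" using 1 2 by simp
qed

section \<open>Logit margins of the DFS action\<close>

definition logit :: "state \<Rightarrow> action \<Rightarrow> real" where
  "logit s a = (case a of
       Down i \<Rightarrow> lam i * zero_weight (\<beta> s) s - ap * down_weight b0 b1 s i
     | Up \<Rightarrow> - q0 * zero_weight (\<beta> s) s + qx * cross_weight (\<beta> s) s)"

text \<open>The penalty of at least \<open>ap / real k / 4\<close> is at least
  \<open>8 * (l + q0 + lam 1)\<close>, which pays for the score \<open>lam i\<close>, the margin and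
  the level \<open>- q0\<close>. The logit of \<open>Up\<close> at an internal node is never below
  that level.\<close>

lemma logit_taken:
  assumes s: "reachable N \<Phi> s" and z: "zero_weight (\<beta> s) s \<le> 1" "0 \<le> zero_weight (\<beta> s) s"
    and i: "i \<in> {1..k}" "(cur_node s, Down i) \<in> taken s"
  shows "logit s (Down i) + 3 * l \<le> - q0"
proof -
  have "lam i * zero_weight (\<beta> s) s \<le> lam 1 * 1"
    using z i lam_antimono[of 1 i] lam_nonneg[of i] by (intro mult_mono) auto
  then show ?thesis
    using down_weight_taken[OF s i(2)] ap(2) l_nonneg q_nonneg lam_1_nonneg by (simp add: logit_def)
qed

lemma logit_margin_down:
  assumes s: "reachable N \<Phi> s" "\<not> success s"
    and t: "t \<in> unvisited_children \<Phi> s" "\<And>j. j \<in> unvisited_children \<Phi> s \<Longrightarrow> t \<le> j"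
    and a: "a \<in> actions k" "a \<noteq> Down t"
  shows "logit s a + 3 * l \<le> logit s (Down t)"
proof -
  have nl: "\<not> is_leaf T (cur_node s)" using t unvisited_children_leaf by blast
  have un: "unvisited_children \<Phi> s = {i \<in> {1..k}. (cur_node s, Down i) \<notin> taken s}"
    by (rule unvisited_children_nonleaf[OF s(1) nl])
  define z w where "z = zero_weight (\<beta> s) s" and "w = cross_weight (\<beta> s) s"
  have zw: "z + w = 1" "0 \<le> w" "1 / 2 \<le> z" "w \<le> z / F"
    using mark_weights_inner[OF s nl] by (simp_all add: z_def w_def)
  have tk: "t \<in> {1..k}" and tf: "(cur_node s, Down t) \<notin> taken s" using t un by auto
  have "0 \<le> lam t * z" using lam_nonneg[of t] tk zw by simp
  then have lt: "- q0 / 16 \<le> logit s (Down t)"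
    using down_weight_fresh(1)[OF s(1) tf] by (simp add: logit_def z_def)
  show ?thesis
  proof (cases a)
    case (Down j)
    then have jk: "j \<in> {1..k}" "j \<noteq> t" using a by (auto simp: actions_def)
    show ?thesis
    proof (cases "(cur_node s, Down j) \<in> taken s")
      case True
      then show ?thesis
        using logit_taken[OF s(1) _ _ jk(1) True] zw lt q_nonneg Down by (simp add: z_def)
    next
      case False
      then have "t < j" using t(2)[of j] un jk by auto
      then have g: "c * q0 \<le> lam t - lam j" "32 * l \<le> lam t - lam j" using lam_gap[of t j] tk jk by auto
      \<comment> \<open>Half of the gap survives as \<open>z\<close> is at least
        \<open>1 / 2\<close>, and the noise of \<open>t\<close> costs at most a quarter of it. The
        remaining quarter is at least \<open>8 * l\<close>; the noise of \<open>j\<close> only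
        helps.\<close>
      have "1 / 2 * (lam t - lam j) \<le> z * (lam t - lam j)"
        using zw g l_nonneg by (intro mult_right_mono) auto
      moreover have "logit s (Down t) - logit s (Down j) =
          z * (lam t - lam j) - ap * down_weight b0 b1 s t + ap * down_weight b0 b1 s j"
        by (simp add: logit_def z_def algebra_simps)
      moreover have "0 \<le> ap * down_weight b0 b1 s j" using ap_nonneg down_weight_nonneg by simp
      ultimately show ?thesis
        using down_weight_fresh(2)[OF s(1) tf] g l_nonneg Down by simp
    qed
  next
    case Up
    \<comment> \<open>The cross term takes back at most a quarter of \<open>q0 * z\<close>, so
      \<open>Up\<close> stays below \<open>- (3 / 8) * q0\<close>, whereas \<open>Down t\<close> is
      at least \<open>- q0 / 16\<close>; the difference of \<open>5 / 16 * q0\<close> is at least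
      \<open>10 * l\<close>.\<close>
    have "qx * w \<le> (q0 / c) * (z / F)"
      using q(1) c zw q_nonneg by (intro mult_mono) (simp_all add: pos_le_divide_eq mult.commute)
    also have "\<dots> = (1 / (c * F)) * (q0 * z)" by simp
    also have "\<dots> \<le> 1 / 4 * (q0 * z)"
    proof (intro mult_right_mono)
      show "1 / (c * F) \<le> 1 / 4" using F(3) F_pos c by (simp add: field_simps)
    qed (use q_nonneg zw in auto)
    finally have "logit s Up \<le> - (3 / 4) * (q0 * z)" by (simp add: logit_def z_def[symmetric] w_def[symmetric])
    moreover have "q0 * (1 / 2) \<le> q0 * z" using q_nonneg zw by (intro mult_left_mono) auto
    ultimately show ?thesis using lt q(3) l_nonneg Up by simp
  qed
qed

text \<open>At an internal node all downward moves are penalised by \<open>logit_taken\<close>. At a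
  leaf no move down was taken, so the dominance of the cross weight decides instead.\<close>

lemma logit_margin_up:
  assumes s: "reachable N \<Phi> s" "\<not> success s" and un: "unvisited_children \<Phi> s = {}"
    and i: "i \<in> {1..k}"
  shows "logit s (Down i) + 3 * l \<le> logit s Up"
proof -
  define z w where "z = zero_weight (\<beta> s) s" and "w = cross_weight (\<beta> s) s"
  show ?thesis
  proof (cases "is_leaf T (cur_node s)")
    case False
    have zw: "z + w = 1" "0 \<le> w" "1 / 2 \<le> z"
      using mark_weights_inner[OF s False] by (simp_all add: z_def w_def)
    have "(cur_node s, Down i) \<in> taken s" using un i unvisited_children_nonleaf[OF s(1) False] by auto
    then have "logit s (Down i) + 3 * l \<le> - q0" using logit_taken[OF s(1) _ _ i] zw by (simp add: z_def)
    moreover have "q0 * z \<le> q0" "0 \<le> qx * w" using zw q_nonneg by (auto intro: mult_left_le)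
    ultimately show ?thesis by (simp add: logit_def z_def w_def)
  next
    case True
    have zw: "z + w = 1" "0 \<le> z" "1 / 2 \<le> w" "z * (real k * F) \<le> 2 * w"
      using mark_weights_leaf[OF s True] by (simp_all add: z_def w_def)
    have k: "real k \<ge> 2" using k2 by simp
    have kF: "0 < real k * F" using k F_pos by simp
    have z: "z \<le> 2 * w / (real k * F)" using zw(4) kF by (simp add: pos_le_divide_eq)
    have qc: "q0 \<le> qx / c" using q(2) c by (simp add: pos_le_divide_eq mult.commute)
    have "q0 * z \<le> (qx / c) * (2 * w / (real k * F))" using qc z zw q_nonneg c by (intro mult_mono) auto
    also have "\<dots> = (2 / (c * (real k * F))) * (qx * w)" by simp
    also have "\<dots> \<le> 1 / 4 * (qx * w)"
    proof (intro mult_right_mono)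
      have "8 \<le> real k * (c * F)" using F(3) c k mult_mono[of 2 "real k" 4 "c * F"] by (simp add: field_simps)
      then show "2 / (c * (real k * F)) \<le> 1 / 4" using c kF by (simp add: field_simps)
    qed (use q_nonneg zw in auto)
    finally have up: "3 / 4 * (qx * w) \<le> logit s Up"
      by (simp add: logit_def z_def[symmetric] w_def[symmetric])
    have "logit s (Down i) \<le> lam i * z"
      using ap_nonneg down_weight_nonneg[of s i] by (simp add: logit_def z_def)
    \<comment> \<open>The factor \<open>k\<close> in the bound on \<open>lam 1\<close> cancels
      against the one in the bound on \<open>z\<close>.\<close>
    also have "\<dots> \<le> (real k * K * q0) * (2 * w / (real k * F))"
      using lam_antimono[of 1 i] lam_1_le i z zw q_nonneg K_pos by (intro mult_mono) auto
    also have "\<dots> = (2 * K / F) * (q0 * w)" using k by simp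
    also have "\<dots> \<le> (2 * K / F) * (qx / c * w)"
      using qc zw K_pos F_pos by (intro mult_left_mono mult_right_mono) auto
    also have "\<dots> = (2 * K / c / F) * (qx * w)" by simp
    also have "\<dots> \<le> 1 / 8 * (qx * w)"
    proof (intro mult_right_mono)
      have "2 * K / c \<le> 1 / 8 * F" using F(1) c by (simp add: field_simps)
      then show "2 * K / c / F \<le> 1 / 8" using F_pos by (simp only: pos_divide_le_eq)
    qed (use q_nonneg zw in auto)
    finally have "logit s (Down i) \<le> 1 / 8 * (qx * w)" .
    moreover have "qx * (1 / 2) \<le> qx * w" using q_nonneg zw by (intro mult_left_mono) auto
    ultimately show ?thesis using up q(4) l_nonneg by simp
  qed
qed

section \<open>From margins to the guarantees on the policy\<close>

definition dfs_action :: "(nat \<Rightarrow> real) \<Rightarrow> state \<Rightarrow> action" where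
  "dfs_action p s = (if unvisited_children \<Phi> s \<noteq> {}
     then Down (arg_max p (\<lambda>j. j \<in> unvisited_children \<Phi> s)) else Up)"

lemma ranked_dfs_eq: "ranked_dfs p \<Phi> s = return_pmf (dfs_action p s)"
  by (simp add: ranked_dfs_def dfs_action_def)

lemma unvisited_children_subset: "unvisited_children \<Phi> s \<subseteq> {1..k}"
  using child_index by (auto simp: unvisited_children_def T_def[symmetric])

lemma logit_margin:
  assumes s: "reachable N \<Phi> s" "\<not> success s" and p: "branch_probs k p"
    and a: "a \<in> actions k" "a \<noteq> dfs_action p s"
  shows "logit s a + 3 * l \<le> logit s (dfs_action p s)"
proof (cases "unvisited_children \<Phi> s = {}")
  case True
  then show ?thesis using a logit_margin_up[OF s True] by (auto simp: dfs_action_def actions_def)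
next
  case False
  note t = arg_max_least[OF p unvisited_children_subset False]
  show ?thesis using logit_margin_down[OF s t a(1)] a(2) False by (simp add: dfs_action_def)
qed

lemma dfs_action_actions:
  assumes "branch_probs k p" shows "dfs_action p s \<in> actions k"
  using arg_max_least(1)[OF assms unvisited_children_subset, of s] unvisited_children_subset[of s]
  by (auto simp: dfs_action_def actions_def)

text \<open>This is why margins are measured as \<open>3 * l\<close>: \<open>exp (- l)\<close> is
  \<open>\<epsilon> / N\<close>, and of its three factors two absorb the \<open>k \<le> N\<close>
  competitors and the 2 in the denominator.\<close>

lemma failure_le: "real k * exp (- (3 * l)) \<le> \<epsilon> / (2 * real N)"
proof -
  have N: "real N \<ge> 2" "real k \<le> real N" using Nk k2 by simp_all
  define r where "r = \<epsilon> / real N"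
  have r: "0 < r" "r \<le> 1 / real N" using eps N by (simp_all add: r_def divide_right_mono)
  have "exp (- (3 * l)) = exp (- l) ^ 3" by (simp flip: exp_of_nat_mult)
  also have "exp (- l) = r" using eps N by (simp add: l_def r_def exp_minus)
  finally have "real k * exp (- (3 * l)) = real k * (r * r) * r" by (simp add: power3_eq_cube)
  also have "\<dots> \<le> real N * (1 / real N * (1 / real N)) * r"
    using r N by (intro mult_mono) auto
  also have "\<dots> = r / real N" using N by simp
  also have "\<dots> \<le> r / 2" using r N by (intro divide_left_mono) auto
  finally show ?thesis by (simp add: r_def)
qed

lemma transformer_close:
  assumes e: "embeddings k N d1 d2 d3 U V Z" and par: "parameters k d1 d2 d3 B C P Q"
    and ind: "induced k N U V Z B C P Q b0 b1 c0 c1 q0 qx ap lam"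
    and p: "branch_probs k p" and s: "reachable N \<Phi> s" "\<not> success s"
  shows "1 - \<epsilon> / (2 * real N) \<le> pmf (transformer_policy k U V Z B C P Q s) (dfs_action p s)"
proof -
  define x where "x = vec (k + 1) (\<lambda>i. logit s (if i < k then Down (i + 1) else Up))"
  have hist: "n \<in> {1..N} \<and> a \<in> actions k" if "(n, a) \<in> taken s" for n a
    using that reachable_actions[OF s(1)] taken_visited reachable_visited_V[OF s(1)] T(3) by blast
  have cur: "cur_node s \<in> {1..N}" using reachable_cur_V[OF s(1)] T(3) by blast
  have dist: "distinct (history s)" using reachable_distinct[OF s(1)] by (simp add: history_def)
  have ind': "transpose_mat U * B * U = A_B N b0 b1" "P * V = A_P k ap"
    "transpose_mat Z * C * Z = A_C c0 c1" "Q * Z = A_Q k lam q0 qx"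
    using ind by (simp_all add: induced_def)
  have node: "P * E_a k V s *\<^sub>v softmax (transpose_mat (E_n U s) * B *\<^sub>v emb_node U (cur_node s))
      = vec (k + 1) (\<lambda>i. if i < k then - ap * down_weight b0 b1 s (i + 1) else 0)"
    by (rule node_attention[OF e par ind'(1,2) dist _ cur]) (rule hist)
  have "transformer_probs k U V Z B C P Q s = softmax x"
    unfolding transformer_probs_def node
      mark_attention[OF e par ind'(3,4) reachable_marks_no_check[OF s]] x_def
    by (intro arg_cong[where f = softmax] eq_vecI) (simp_all add: logit_def)
  moreover have "dim_vec x = k + 1" by (simp add: x_def)
  ultimately have pmf: "pmf (transformer_policy k U V Z B C P Q s) a = (case a of
       Down i \<Rightarrow> if i \<in> {1..k} then softmax x $ (i - 1) else 0 | Up \<Rightarrow> softmax x $ k)" for a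
    by (rule transformer_policy_pmf)
  define t where "t = (case dfs_action p s of Down i \<Rightarrow> i - 1 | Up \<Rightarrow> k)"
  have t: "t < k + 1" "pmf (transformer_policy k U V Z B C P Q s) (dfs_action p s) = softmax x $ t"
    "dfs_action p s = (if t < k then Down (t + 1) else Up)"
    using dfs_action_actions[OF p, of s] by (auto simp: t_def pmf actions_def)
  have "softmax x $ t \<ge> 1 - real (dim_vec x - 1) * exp (- (3 * l))"
  proof (rule softmax_margin)
    fix j assume j: "j < dim_vec x" "j \<noteq> t"
    let ?a = "if j < k then Down (j + 1) else Up"
    have "?a \<in> actions k" by (simp add: actions_def)
    moreover have "?a \<noteq> dfs_action p s" using j t(1,3) by (auto simp: x_def split: if_splits)
    ultimately have "logit s ?a + 3 * l \<le> logit s (dfs_action p s)" by (rule logit_margin[OF s p])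
    then show "x $ j + 3 * l \<le> x $ t" using j t(1) unfolding t(3) by (simp add: x_def)
  qed (use t in \<open>simp add: x_def\<close>)
  then show ?thesis using failure_le by (simp add: t(2) x_def)
qed

text \<open>A failure probability of \<open>\<epsilon> / (2 * N)\<close> per state gives the
  distance directly and adds up to \<open>\<epsilon>\<close> over the \<open>2 * N\<close> moves of
  an episode.\<close>

lemma transformer_guarantee:
  assumes e: "embeddings k N d1 d2 d3 U V Z" and par: "parameters k d1 d2 d3 B C P Q"
    and ind: "induced k N U V Z B C P Q b0 b1 c0 c1 q0 qx ap lam"
    and p: "branch_probs k p"
  defines "\<pi> \<equiv> transformer_policy k U V Z B C P Q"
  shows "1 - \<epsilon> \<le> success_prob N \<pi> \<Phi>"
    and "reachable N \<Phi> s \<Longrightarrow> \<not> success s \<Longrightarrow> sup_dist k (\<pi> s) (ranked_dfs p \<Phi> s) \<le> \<epsilon> / (2 * real N)"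
proof -
  have N: "real N \<ge> 1" using Nk by simp
  have "success_prob N \<pi> \<Phi> \<ge> 1 - 2 * real N * (\<epsilon> / (2 * real N))"
  proof (rule success_prob_ge)
    show "if unvisited_children \<Phi> s \<noteq> {} then \<exists>j\<in>unvisited_children \<Phi> s. dfs_action p s = Down j
        else dfs_action p s = Up" for s
      using arg_max_least(1)[OF p unvisited_children_subset, of s] by (auto simp: dfs_action_def)
    show "\<epsilon> / (2 * real N) \<le> 1" using eps N by (simp add: divide_le_eq)
  qed (use transformer_close[OF e par ind p] eps N in \<open>auto simp: \<pi>_def\<close>)
  then show "1 - \<epsilon> \<le> success_prob N \<pi> \<Phi>" using N by simp
  show "sup_dist k (\<pi> s) (ranked_dfs p \<Phi> s) \<le> \<epsilon> / (2 * real N)"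
    if "reachable N \<Phi> s" "\<not> success s"
    using sup_dist_return[OF transformer_close[OF e par ind p that] dfs_action_actions[OF p]]
    by (simp add: ranked_dfs_eq \<pi>_def)
qed

end

section \<open>Choice of the absolute constants\<close>

lemma tree_size_gt:
  fixes k L N :: nat
  assumes "2 \<le> k" "1 \<le> L" "(real k ^ (L + 1) - 1) / (real k - 1) \<le> real N"
  shows "k < N"
proof -
  have k: "real k - 1 > 0" using assms(1) by simp
  \<comment> \<open>The case \<open>L = 1\<close> is the weakest, and there the quotient is
    \<open>k + 1\<close>.\<close>
  have "real k ^ 2 \<le> real k ^ (L + 1)" using assms by (intro power_increasing) auto
  then have "(real k ^ 2 - 1) / (real k - 1) \<le> (real k ^ (L + 1) - 1) / (real k - 1)"
    using k by (intro divide_right_mono) auto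
  also have "(real k ^ 2 - 1) / (real k - 1) = real k + 1"
    using k by (simp add: field_simps power2_eq_square)
  finally show ?thesis using assms(3) by linarith
qed

text \<open>\<open>C1\<close> is the sum of the nonnegative lower bounds that \<open>trained\<close>
  puts on \<open>F\<close>, so \<open>ln_floor C1 k\<close> exceeds each of them for every
  \<open>k\<close>.\<close>

lemma transformer_performs_dfs:
  fixes c :: real
  assumes c: "c > 0"
  defines "K \<equiv> 1 / c + 1 / c\<^sup>2"
  defines "C1 \<equiv> 16 * K / c + 4 * K / c\<^sup>2 + 4 / c + 2"
  assumes k: "k \<ge> 2" and L: "L \<ge> 1" and N: "real N \<ge> (real k ^ (L + 1) - 1) / (real k - 1)"
    and eps: "0 < \<epsilon>" "\<epsilon> \<le> 1"
    and emb: "embeddings k N d1 d2 d3 U V Z" and par: "parameters k d1 d2 d3 B C P Q"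
    and ind: "induced k N U V Z B C P Q ab0 ab1 ac0 ac1 aq0 aqx ap1 lam"
    and p: "branch_probs k p"
    and a: "exp ac0 \<ge> ln_floor C1 k" "exp ac1 \<ge> sqrt (real N * real k) * ln_floor C1 k"
      "exp ab0 \<ge> real N * real k * ln_floor C1 k" "exp ab1 \<ge> ln (real k) * exp ab0"
    and gap: "\<forall>i\<in>{1..<k}. comparable c (lam i - lam (i + 1)) aq0"
    and q: "comparable c aq0 aqx" "gtrsim c aqx (lam k)" "lam k \<ge> 0"
    and gapl: "\<forall>i\<in>{1..<k}. lam i - lam (i + 1) \<ge> 32 * ln (real N / \<epsilon>)"
    and ql: "aq0 \<ge> 32 * ln (real N / \<epsilon>)" "aqx \<ge> 32 * ln (real N / \<epsilon>)"
    and ap: "comparable c (ap1 / real k) (lam 1)"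
      "ap1 / real k \<ge> 32 * (ln (real N / \<epsilon>) + aq0 + lam 1)"
    and env: "environment k N L \<Phi>"
  shows "success_prob N (transformer_policy k U V Z B C P Q) \<Phi> \<ge> 1 - \<epsilon>"
    and "reachable N \<Phi> s \<Longrightarrow> \<not> success s \<Longrightarrow>
      sup_dist k (transformer_policy k U V Z B C P Q s) (ranked_dfs p \<Phi> s) \<le> \<epsilon> / (2 * real N)"
proof -
  have K: "0 \<le> 16 * K / c" "0 \<le> 4 * K / c\<^sup>2" "0 \<le> 4 / c" using c by (simp_all add: K_def)
  have "C1 \<le> ln_floor C1 k" by (simp add: ln_floor_def)
  then have F: "16 * K / c \<le> ln_floor C1 k" "4 * K / c\<^sup>2 \<le> ln_floor C1 k"
      "4 / c \<le> ln_floor C1 k" "2 \<le> ln_floor C1 k"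
    using K unfolding C1_def by linarith+
  interpret trained k N L \<Phi> "fst \<Phi>" "snd \<Phi>" \<epsilon> c K "ln_floor C1 k" "ln (real N / \<epsilon>)" ab0 ab1 ac0 ac1 aq0 aqx ap1 lam
    by unfold_locales
      (use assms tree_size_gt[OF k L N] K F in
        \<open>auto simp: comparable_def gtrsim_def K_def[symmetric] C1_def[symmetric]\<close>)
  show "success_prob N (transformer_policy k U V Z B C P Q) \<Phi> \<ge> 1 - \<epsilon>"
    by (rule transformer_guarantee(1)[OF emb par ind p])
  show "sup_dist k (transformer_policy k U V Z B C P Q s) (ranked_dfs p \<Phi> s) \<le> \<epsilon> / (2 * real N)"
    if "reachable N \<Phi> s" "\<not> success s"
    by (rule transformer_guarantee(2)[OF emb par ind p that])
qed

lemma floor_constant_pos: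
  fixes c :: real
  assumes "c > 0"
  shows "16 * (1 / c + 1 / c\<^sup>2) / c + 4 * (1 / c + 1 / c\<^sup>2) / c\<^sup>2 + 4 / c + 2 > 0"
  using assms by (intro add_pos_pos divide_pos_pos mult_pos_pos) auto

theorem theorem4:
  shows
  "(\<forall>(k::nat) (N::nat) (d1::nat) (d2::nat) (d3::nat) (U::real mat) (V::real mat) (Z::real mat)
      (ab0::real) (ab1::real) (ac0::real) (ac1::real) (aq0::real) (aqx::real) (ap1::real)
      (lam::nat \<Rightarrow> real).
      k \<ge> 2 \<longrightarrow> embeddings k N d1 d2 d3 U V Z \<longrightarrow>
      (\<exists>B C P Q. parameters k d1 d2 d3 B C P Q \<and>
         induced k N U V Z B C P Q ab0 ab1 ac0 ac1 aq0 aqx ap1 lam))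
   \<and>
   (\<exists>C0>0. \<forall>c>0. \<exists>C1>0.
      \<forall>(k::nat) (L::nat) (N::nat) (\<epsilon>::real)
       (d1::nat) (d2::nat) (d3::nat) (U::real mat) (V::real mat) (Z::real mat)
       (B::real mat) (C::real mat) (P::real mat) (Q::real mat)
       (ab0::real) (ab1::real) (ac0::real) (ac1::real) (aq0::real) (aqx::real) (ap1::real)
       (lam::nat \<Rightarrow> real) (p::nat \<Rightarrow> real).
      k \<ge> 2 \<longrightarrow> L \<ge> 1 \<longrightarrow> real N \<ge> (real k ^ (L + 1) - 1) / (real k - 1) \<longrightarrow>
      0 < \<epsilon> \<longrightarrow> \<epsilon> \<le> 1 \<longrightarrow>
      embeddings k N d1 d2 d3 U V Z \<longrightarrow>
      parameters k d1 d2 d3 B C P Q \<longrightarrow>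
      induced k N U V Z B C P Q ab0 ab1 ac0 ac1 aq0 aqx ap1 lam \<longrightarrow>
      branch_probs k p \<longrightarrow>
      exp ac0 \<ge> ln_floor C1 k \<longrightarrow>
      exp ac1 \<ge> sqrt (real N * real k) * ln_floor C1 k \<longrightarrow>
      exp ab0 \<ge> real N * real k * ln_floor C1 k \<longrightarrow>
      exp ab1 \<ge> ln (real k) * exp ab0 \<longrightarrow>
      (\<forall>i\<in>{1..<k}. comparable c (lam i - lam (i + 1)) aq0) \<longrightarrow>
      comparable c aq0 aqx \<longrightarrow>
      gtrsim c aqx (lam k) \<longrightarrow>
      lam k \<ge> 0 \<longrightarrow>
      (\<forall>i\<in>{1..<k}. lam i - lam (i + 1) \<ge> C0 * ln (real N / \<epsilon>)) \<longrightarrow>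
      aq0 \<ge> C0 * ln (real N / \<epsilon>) \<longrightarrow>
      aqx \<ge> C0 * ln (real N / \<epsilon>) \<longrightarrow>
      comparable c (ap1 / real k) (lam 1) \<longrightarrow>
      ap1 / real k \<ge> C0 * (ln (real N / \<epsilon>) + aq0 + lam 1) \<longrightarrow>
      (\<forall>\<Phi>. environment k N L \<Phi> \<longrightarrow>
         success_prob N (transformer_policy k U V Z B C P Q) \<Phi> \<ge> 1 - \<epsilon> \<and>
         (\<forall>s. reachable N \<Phi> s \<longrightarrow> \<not> success s \<longrightarrow>
            sup_dist k (transformer_policy k U V Z B C P Q s) (ranked_dfs p \<Phi> s) \<le> \<epsilon> / (2 * real N))))"
proof (rule conjI, goal_cases)
  case 1
  show ?case using induced_parameters_exist by blast
next
  case 2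
  show ?case
  proof (rule exI[of _ 32], rule conjI, simp, intro allI impI, goal_cases)
    case c: (1 c)
    show ?case
    \<comment> \<open>The witness for \<open>C1\<close> stays schematic in \<open>exI\<close> and is
      fixed by \<open>floor_constant_pos\<close>; it depends on \<open>c\<close> only, while 32
      serves as \<open>C0\<close> for all \<open>c\<close>.\<close>
    proof (rule exI, rule conjI[OF floor_constant_pos[OF c]], intro allI impI conjI, goal_cases)
      case 1
      then show ?case by (rule transformer_performs_dfs(1)[OF c])
    next
      case 2
      then show ?case by (rule transformer_performs_dfs(2)[OF c])
    qed
  qed
qed

end
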